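(* For any fixed integer $(r,s)\times t$ bimatrix $A$, there is an algorithm that, given a positive integer $n$, vectors $b\in\mathbb{Z}^{r+ns}$ and $l,u\in\mathbb{Z}^{nt}$, a separable convex function $f:\mathbb{R}^{nt}\to\mathbb{R}$ presented by a comparison oracle, and a feasible point $x$ in the program $$\min\left\{f(x)\ :\ A^{(n)}x=b,\ l\leq x\leq u,\ x\in\mathbb{Z}^{nt}\right\},$$ either asserts that $x$ is optimal or finds an augmenting step $g$ for $x$ which satisfies $f(x+g)\leq f(x+\bar g)$ for any feasible step $\bar g\in\mathcal{G}(A^{(n)})$ for $x$, in linear time $O(n)$.
   Context: An $(r,s)\times t$ bimatrix $A$ is an $(r+s)\times t$ matrix viewed as consisting of two blocks: $A_1$, its $r\times t$ submatrix of the first $r$ rows, and $A_2$, its $s\times t$ submatrix of the last $s$ rows. Its $n$-fold product is the $(r+ns)\times nt$ matrix $$A^{(n)}:=\begin{pmatrix} A_1&A_1&\cdots&A_1\\ A_2&0&\cdots&0\\ 0&A_2&\cdots&0\\ \vdots&\vdots&\ddots&\vdots\\ 0&0&\cdots&A_2\end{pmatrix}.$$ Vectors in $\mathbb{R}^{nt}$ are written as $x=(x^1,\dots,x^n)$ with bricks $x^i\in\mathbb{R}^t$. The function $f$ is separable convex if $f(x)=\sum_{i=1}^n\sum_{j=1}^t f^i_j(x^i_j)$ with each $f^i_j:\mathbb{R}\to\mathbb{R}$ univariate convex. A comparison oracle for $f$, queried on two vectors $x,y$, asserts whether or not $f(x)\leq f(y)$. Define a partial order on $\mathbb{R}^N$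 by $x\sqsubseteq y$ if $x_iy_i\geq 0$ and $|x_i|\leq|y_i|$ for all $i$. The Graver basis $\mathcal{G}(M)$ of an integer matrix $M$ with $N$ columns is the finite set of $\sqsubseteq$-minimal elements of $\{x\in\mathbb{Z}^N: Mx=0,\ x\neq 0\}$. A feasible step for a feasible point $x$ is a vector $v$ such that $x+v$ is also feasible (satisfies all constraints of the program, including integrality). An augmenting step for $x$ is a feasible step $v$ with $f(x+v)<f(x)$. "Time" is the number of arithmetic operations (additions, multiplications, divisions, comparisons) and oracle queries. The constant hidden in $O(\cdot)$ depends only on the fixed bimatrix $A$. *)

theory Defs
  imports "Jordan_Normal_Form.Matrix" "HOL-Analysis.Convex"
begin

section \<open>Bimatrices and n-fold products\<close>

(* An (r,s) x t bimatrix is an (r+s) x t matrix together with the split r + s of its rows. *)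

definition upper_block :: "nat \<Rightarrow> 'a mat \<Rightarrow> 'a mat" where
  "upper_block r A = mat r (dim_col A) (\<lambda>(i, j). A $$ (i, j))"

definition lower_block :: "nat \<Rightarrow> nat \<Rightarrow> 'a mat \<Rightarrow> 'a mat" where
  "lower_block r s A = mat s (dim_col A) (\<lambda>(i, j). A $$ (r + i, j))"

(* Column j lies in block column j div t, at position j mod t of that block; row r + i lies in
   the (i div s)-th row of blocks below the first one, at position i mod s. *)
definition nfold :: "nat \<Rightarrow> nat \<Rightarrow> nat \<Rightarrow> 'a::zero mat \<Rightarrow> nat \<Rightarrow> 'a mat" where
  "nfold r s t A n = mat (r + n * s) (n * t) (\<lambda>(i, j).
     if i < r then upper_block r A $$ (i, j mod t)
     else if (i - r) div s = j div t then lower_block r s A $$ ((i - r) mod s, j mod t)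
     else 0)"


section \<open>Graver bases\<close>

definition conformal_le :: "'a::linordered_idom vec \<Rightarrow> 'a vec \<Rightarrow> bool" where
  "conformal_le x y \<longleftrightarrow> dim_vec x = dim_vec y \<and>
     (\<forall>i < dim_vec x. 0 \<le> x $ i * y $ i \<and> \<bar>x $ i\<bar> \<le> \<bar>y $ i\<bar>)"

definition nonzero_kernel :: "int mat \<Rightarrow> int vec set" where
  "nonzero_kernel M = {x \<in> carrier_vec (dim_col M).
     M *\<^sub>v x = 0\<^sub>v (dim_row M) \<and> x \<noteq> 0\<^sub>v (dim_col M)}"

definition Graver :: "int mat \<Rightarrow> int vec set" where
  "Graver M = {x \<in> nonzero_kernel M. \<forall>y \<in> nonzero_kernel M. conformal_le y x \<longrightarrow> y = x}"


section \<open>The integer program\<close>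

(* Coordinate j of brick i (both counted from 0) of a vector of dimension n * t is its entry
   i * t + j. *)
definition separable_convex :: "nat \<Rightarrow> nat \<Rightarrow> (real vec \<Rightarrow> real) \<Rightarrow> bool" where
  "separable_convex n t f \<longleftrightarrow> (\<exists>\<phi> :: nat \<Rightarrow> nat \<Rightarrow> real \<Rightarrow> real.
     (\<forall>i < n. \<forall>j < t. convex_on UNIV (\<phi> i j)) \<and>
     (\<forall>x \<in> carrier_vec (n * t). f x = (\<Sum>i<n. \<Sum>j<t. \<phi> i j (x $ (i * t + j)))))"

abbreviation at_int :: "(real vec \<Rightarrow> real) \<Rightarrow> int vec \<Rightarrow> real" where
  "at_int f x \<equiv> f (map_vec real_of_int x)"

definition feasible :: "int mat \<Rightarrow> int vec \<Rightarrow> int vec \<Rightarrow> int vec \<Rightarrow> int vec \<Rightarrow> bool" where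
  "feasible M b l u x \<longleftrightarrow>
     x \<in> carrier_vec (dim_col M) \<and> M *\<^sub>v x = b \<and> l \<le> x \<and> x \<le> u"

definition optimal ::
  "int mat \<Rightarrow> int vec \<Rightarrow> int vec \<Rightarrow> int vec \<Rightarrow> (real vec \<Rightarrow> real) \<Rightarrow> int vec \<Rightarrow> bool" where
  "optimal M b l u f x \<longleftrightarrow>
     feasible M b l u x \<and> (\<forall>y. feasible M b l u y \<longrightarrow> at_int f x \<le> at_int f y)"

definition feasible_step ::
  "int mat \<Rightarrow> int vec \<Rightarrow> int vec \<Rightarrow> int vec \<Rightarrow> int vec \<Rightarrow> int vec \<Rightarrow> bool" where
  "feasible_step M b l u x v \<longleftrightarrow> v \<in> carrier_vec (dim_col M) \<and> feasible M b l u (x + v)"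

definition augmenting_step ::
  "int mat \<Rightarrow> int vec \<Rightarrow> int vec \<Rightarrow> int vec \<Rightarrow> (real vec \<Rightarrow> real) \<Rightarrow> int vec \<Rightarrow> int vec \<Rightarrow> bool" where
  "augmenting_step M b l u f x v \<longleftrightarrow>
     feasible_step M b l u x v \<and> at_int f (x + v) < at_int f x"


section \<open>The computation model\<close>

(* Algorithms are programs of a While language over unbounded integers, with finitely many scalar
   variables and arrays (both named by numbers).  A program is a finite text in which n, the input
   vectors and f do not occur, and f can be accessed only through the test Compare.

   The number of arithmetic operations and comparison queries is bounded by the number of steps
   counted here: every node of an evaluated expression or test and every executed command costs
   one.  In particular a query costs one, and so does an array copy, which involves no
   arithmetic. *)

datatype aexp =
    Const int
  | Scalar nat
  | Entry nat aexp  (* Entry a e: the entry of array a at index e *)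
  | Plus aexp aexp
  | Minus aexp aexp
  | Times aexp aexp
  | Div aexp aexp

datatype bexp =
    LessEq aexp aexp
  | Compare nat nat  (* Compare a b: f at array a is at most f at array b *)
  | Neg bexp
  | Conj bexp bexp

datatype com =
    Skip
  | Assign nat aexp
  | Store nat aexp aexp  (* Store a i e: write e to array a at index i *)
  | Copy nat nat  (* Copy a b: array a becomes a copy of array b *)
  | Seq com com
  | If bexp com com
  | While bexp com

type_synonym array = "int \<Rightarrow> int"

datatype state = State (scalars: "nat \<Rightarrow> int") (arrays: "nat \<Rightarrow> array")

primrec aval :: "aexp \<Rightarrow> state \<Rightarrow> int" where
  "aval (Const c) \<sigma> = c"
| "aval (Scalar v) \<sigma> = scalars \<sigma> v"
| "aval (Entry a e) \<sigma> = arrays \<sigma> a (aval e \<sigma>)"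
| "aval (Plus e e') \<sigma> = aval e \<sigma> + aval e' \<sigma>"
| "aval (Minus e e') \<sigma> = aval e \<sigma> - aval e' \<sigma>"
| "aval (Times e e') \<sigma> = aval e \<sigma> * aval e' \<sigma>"
| "aval (Div e e') \<sigma> = aval e \<sigma> div aval e' \<sigma>"

primrec acost :: "aexp \<Rightarrow> nat" where
  "acost (Const c) = 1"
| "acost (Scalar v) = 1"
| "acost (Entry a e) = 1 + acost e"
| "acost (Plus e e') = 1 + acost e + acost e'"
| "acost (Minus e e') = 1 + acost e + acost e'"
| "acost (Times e e') = 1 + acost e + acost e'"
| "acost (Div e e') = 1 + acost e + acost e'"

primrec bval :: "(array \<Rightarrow> array \<Rightarrow> bool) \<Rightarrow> bexp \<Rightarrow> state \<Rightarrow> bool" where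
  "bval cmp (LessEq e e') \<sigma> = (aval e \<sigma> \<le> aval e' \<sigma>)"
| "bval cmp (Compare a b) \<sigma> = cmp (arrays \<sigma> a) (arrays \<sigma> b)"
| "bval cmp (Neg c) \<sigma> = (\<not> bval cmp c \<sigma>)"
| "bval cmp (Conj c c') \<sigma> = (bval cmp c \<sigma> \<and> bval cmp c' \<sigma>)"

primrec bcost :: "bexp \<Rightarrow> nat" where
  "bcost (LessEq e e') = 1 + acost e + acost e'"
| "bcost (Compare a b) = 1"
| "bcost (Neg c) = 1 + bcost c"
| "bcost (Conj c c') = 1 + bcost c + bcost c'"

(* exec cmp c \<sigma> k \<tau>: started in state \<sigma>, the program c terminates in state \<tau> after k steps. *)
inductive exec ::
  "(array \<Rightarrow> array \<Rightarrow> bool) \<Rightarrow> com \<Rightarrow> state \<Rightarrow> nat \<Rightarrow> state \<Rightarrow> bool"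
  for cmp :: "array \<Rightarrow> array \<Rightarrow> bool" where
  Skip: "exec cmp Skip \<sigma> 1 \<sigma>"
| Assign: "exec cmp (Assign v e) \<sigma> (1 + acost e)
     (State ((scalars \<sigma>)(v := aval e \<sigma>)) (arrays \<sigma>))"
| Store: "exec cmp (Store a i e) \<sigma> (1 + acost i + acost e)
     (State (scalars \<sigma>) ((arrays \<sigma>)(a := (arrays \<sigma> a)(aval i \<sigma> := aval e \<sigma>))))"
| Copy: "exec cmp (Copy a b) \<sigma> 1 (State (scalars \<sigma>) ((arrays \<sigma>)(a := arrays \<sigma> b)))"
| Seq: "exec cmp c \<sigma> k \<sigma>' \<Longrightarrow> exec cmp c' \<sigma>' k' \<tau> \<Longrightarrow> exec cmp (Seq c c') \<sigma> (1 + k + k') \<tau>"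
| IfTrue: "bval cmp p \<sigma> \<Longrightarrow> exec cmp c \<sigma> k \<tau> \<Longrightarrow> exec cmp (If p c c') \<sigma> (1 + bcost p + k) \<tau>"
| IfFalse: "\<not> bval cmp p \<sigma> \<Longrightarrow> exec cmp c' \<sigma> k \<tau> \<Longrightarrow>
     exec cmp (If p c c') \<sigma> (1 + bcost p + k) \<tau>"
| WhileFalse: "\<not> bval cmp p \<sigma> \<Longrightarrow> exec cmp (While p c) \<sigma> (1 + bcost p) \<sigma>"
| WhileTrue: "bval cmp p \<sigma> \<Longrightarrow> exec cmp c \<sigma> k \<sigma>' \<Longrightarrow> exec cmp (While p c) \<sigma>' k' \<tau> \<Longrightarrow>
     exec cmp (While p c) \<sigma> (1 + bcost p + k + k') \<tau>"

lemma exec_deterministic: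
  "exec cmp c \<sigma> k \<tau> \<Longrightarrow> exec cmp c \<sigma> k' \<tau>' \<Longrightarrow> k' = k \<and> \<tau>' = \<tau>"
proof (induction arbitrary: k' \<tau>' rule: exec.induct)
  case (Skip \<sigma>)
  then show ?case by cases simp
next
  case (Assign v e \<sigma>)
  then show ?case by cases simp
next
  case (Store a i e \<sigma>)
  then show ?case by cases simp
next
  case (Copy a b \<sigma>)
  then show ?case by cases simp
next
  case (Seq c \<sigma> k1 \<sigma>1 c' k2 \<tau>)
  from Seq.prems show ?case
  proof cases
    case (Seq j1 \<sigma>2 j2)
    then show ?thesis using Seq.IH(1)[of j1 \<sigma>2] Seq.IH(2)[of j2 \<tau>'] by simp
  qed
next
  case (IfTrue p \<sigma> c k1 \<tau> c')
  from IfTrue.prems show ?case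
  proof cases
    case (IfTrue j)
    then show ?thesis using IfTrue.IH[of j \<tau>'] by simp
  qed (use IfTrue.hyps in simp)
next
  case (IfFalse p \<sigma> c' k1 \<tau> c)
  from IfFalse.prems show ?case
  proof cases
    case (IfFalse j)
    then show ?thesis using IfFalse.IH[of j \<tau>'] by simp
  qed (use IfFalse.hyps in simp)
next
  case (WhileFalse p \<sigma> c)
  from WhileFalse.prems show ?case
    by cases (use WhileFalse.hyps in simp_all)
next
  case (WhileTrue p \<sigma> c k1 \<sigma>1 k2 \<tau>)
  from WhileTrue.prems show ?case
  proof cases
    case (WhileTrue j1 \<sigma>2 j2)
    then show ?thesis using WhileTrue.IH(1)[of j1 \<sigma>2] WhileTrue.IH(2)[of j2 \<tau>'] by simp
  qed (use WhileTrue.hyps in simp)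
qed


section \<open>Input, comparison queries and output\<close>

definition array_of_vec :: "int vec \<Rightarrow> array" where
  "array_of_vec v = (\<lambda>k. if 0 \<le> k \<and> k < int (dim_vec v) then v $ nat k else 0)"

definition vec_of_array :: "nat \<Rightarrow> array \<Rightarrow> int vec" where
  "vec_of_array N a = vec N (\<lambda>k. a (int k))"

(* Scalar 0 holds n and arrays 0, 1, 2, 3 hold b, l, u, x; everything else is 0. *)
definition input_state :: "nat \<Rightarrow> int vec \<Rightarrow> int vec \<Rightarrow> int vec \<Rightarrow> int vec \<Rightarrow> state" where
  "input_state n b l u x = State ((\<lambda>_. 0)(0 := int n))
     ((\<lambda>_ _. 0)(0 := array_of_vec b, 1 := array_of_vec l, 2 := array_of_vec u,
       3 := array_of_vec x))"

definition comparison :: "nat \<Rightarrow> (real vec \<Rightarrow> real) \<Rightarrow> array \<Rightarrow> array \<Rightarrow> bool" where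
  "comparison N f a b \<longleftrightarrow> at_int f (vec_of_array N a) \<le> at_int f (vec_of_array N b)"

datatype answer = Is_Optimal | Step "int vec"

(* A final value 0 of scalar 0 asserts optimality; otherwise array 0 holds the step found. *)
definition answer_of :: "nat \<Rightarrow> state \<Rightarrow> answer" where
  "answer_of N \<sigma> = (if scalars \<sigma> 0 = 0 then Is_Optimal else Step (vec_of_array N (arrays \<sigma> 0)))"

end

theory Submission
  imports Defs
begin

text \<open>
  The bricks of an element \<open>g\<close> of the Graver basis of the \<open>n\<close>-fold product lie in the kernel of the
  lower block, so each of them is a conformal sum of elements of the finite Graver basis of that
  block. The vector that counts how often these parts occur in all of \<open>g\<close> is a minimal nonzero
  solution of a homogeneous system that does not depend on \<open>n\<close>. By Dickson's lemma there are only
  finitely many such solutions, and hence all partial sums of bricks of \<open>g\<close> lie in a finite set \<open>Z\<close>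
  that depends on \<open>A\<close> only.

  A dynamic program with state set \<open>Z\<close> chooses the bricks one by one and keeps, for each state, a
  best point \<open>x + g\<close> whose bricks chosen so far sum up to that state. Partial solutions can be
  compared by the oracle for \<open>f\<close>, because \<open>f\<close> is separable and the remaining bricks of \<open>g\<close> are still
  zero. If the point found in the end does not improve on \<open>x\<close>, then no Graver step does, and \<open>x\<close>
  is optimal by convexity: \<open>y - x\<close> is a conformal sum of Graver steps for every feasible \<open>y\<close>.
\<close>

section \<open>Dickson's lemma\<close>

lemma nat_seq_mono_subseq:
  fixes s :: "nat \<Rightarrow> nat"
  shows "\<exists>\<phi> :: nat \<Rightarrow> nat. strict_mono \<phi> \<and> mono (\<lambda>n. s (\<phi> n))"
proof -
  obtain \<phi> :: "nat \<Rightarrow> nat" where \<phi>: "strict_mono \<phi>" "monoseq (\<lambda>n. s (\<phi> n))"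
    using seq_monosub by blast
  show ?thesis
  proof (cases "incseq (\<lambda>n. s (\<phi> n))")
    case False
    then have dec: "decseq (\<lambda>n. s (\<phi> n))"
      using \<phi>(2) by (simp add: monoseq_iff)
    obtain m where m: "\<And>n. s (\<phi> m) \<le> s (\<phi> n)"
      using ex_has_least_nat[of "\<lambda>_. True" 0 "\<lambda>n. s (\<phi> n)"] by auto
    have "s (\<phi> (m + n)) = s (\<phi> m)" for n
      using m decseqD[OF dec, of m "m + n"] by (simp add: le_antisym)
    moreover have "strict_mono (\<lambda>n. \<phi> (m + n))"
      using \<phi>(1) by (simp add: strict_mono_def)
    ultimately show ?thesis by (intro exI[of _ "\<lambda>n. \<phi> (m + n)"]) (simp add: mono_def)
  qed (use \<phi> in auto)
qed

lemma dickson_subseq: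
  fixes s :: "nat \<Rightarrow> 'a \<Rightarrow> nat"
  assumes "finite I"
  shows "\<exists>\<phi> :: nat \<Rightarrow> nat. strict_mono \<phi> \<and> (\<forall>i\<in>I. mono (\<lambda>n. s (\<phi> n) i))"
  using assms
proof (induction I)
  case empty
  then show ?case by (auto intro: exI[of _ id] simp: strict_mono_def)
next
  case (insert a I)
  then obtain \<phi> :: "nat \<Rightarrow> nat" where \<phi>: "strict_mono \<phi>" "\<forall>i\<in>I. mono (\<lambda>n. s (\<phi> n) i)" by blast
  obtain \<psi> :: "nat \<Rightarrow> nat" where \<psi>: "strict_mono \<psi>" "mono (\<lambda>n. s (\<phi> (\<psi> n)) a)"
    using nat_seq_mono_subseq[of "\<lambda>n. s (\<phi> n) a"] by blast
  have "mono (\<lambda>n. s (\<phi> (\<psi> n)) i)" if "i \<in> I" for i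
    using that \<phi>(2) strict_mono_leD[OF \<psi>(1)] by (auto simp: mono_def)
  then show ?case
    using \<psi>(2) strict_mono_o[OF \<phi>(1) \<psi>(1)] by (intro exI[of _ "\<lambda>n. \<phi> (\<psi> n)"]) (auto simp: o_def)
qed

lemma dickson:
  fixes e :: "'b \<Rightarrow> 'a \<Rightarrow> nat"
  assumes "finite I"
    and antichain: "\<And>x y. x \<in> S \<Longrightarrow> y \<in> S \<Longrightarrow> \<forall>i\<in>I. e x i \<le> e y i \<Longrightarrow> x = y"
  shows "finite S"
proof (rule ccontr)
  assume "infinite S"
  then obtain q :: "nat \<Rightarrow> 'b" where q: "inj q" "range q \<subseteq> S"
    using infinite_countable_subset by blast
  obtain \<phi> :: "nat \<Rightarrow> nat" where \<phi>: "strict_mono \<phi>" "\<forall>i\<in>I. mono (\<lambda>n. e (q (\<phi> n)) i)"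
    using dickson_subseq[OF assms(1), of "\<lambda>n. e (q n)"] by blast
  have "q (\<phi> 0) = q (\<phi> 1)"
    using q(2) \<phi>(2) by (intro antichain) (auto simp: mono_def)
  then have "\<phi> 0 = \<phi> 1" using q(1) by (auto dest: injD)
  moreover have "\<phi> 0 < \<phi> 1" using \<phi>(1) by (simp add: strict_mono_def)
  ultimately show False by simp
qed

section \<open>Graver bases\<close>

lemma conformal_entry_iff:
  fixes a b :: int
  shows "0 \<le> a * b \<and> \<bar>a\<bar> \<le> \<bar>b\<bar> \<longleftrightarrow> 0 \<le> a \<and> a \<le> b \<or> b \<le> a \<and> a \<le> 0"
  by (auto simp: zero_le_mult_iff)

lemma conformal_le_iff:
  fixes x y :: "int vec"
  shows "conformal_le x y \<longleftrightarrow> dim_vec x = dim_vec y \<and>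
    (\<forall>i < dim_vec x. 0 \<le> x $ i \<and> x $ i \<le> y $ i \<or> y $ i \<le> x $ i \<and> x $ i \<le> 0)"
  unfolding conformal_le_def conformal_entry_iff ..

lemma conformal_le_trans:
  fixes x y z :: "int vec"
  shows "conformal_le x y \<Longrightarrow> conformal_le y z \<Longrightarrow> conformal_le x z"
  unfolding conformal_le_iff by force

definition norm1 :: "int vec \<Rightarrow> nat" where
  "norm1 v = (\<Sum>i<dim_vec v. nat \<bar>v $ i\<bar>)"

lemma norm1_eq_0_iff: "norm1 v = 0 \<longleftrightarrow> v = 0\<^sub>v (dim_vec v)"
  by (auto simp: norm1_def vec_eq_iff)

lemma norm1_conformal_diff:
  assumes "conformal_le h v"
  shows "norm1 (v - h) + norm1 h = norm1 v"
proof -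
  have "nat \<bar>v $ i - h $ i\<bar> + nat \<bar>h $ i\<bar> = nat \<bar>v $ i\<bar>" if "i < dim_vec h" for i
    using assms that unfolding conformal_le_iff by force
  then show ?thesis
    using assms unfolding norm1_def conformal_le_def by (simp flip: sum.distrib)
qed

lemma conformal_diff:
  fixes h v :: "int vec"
  assumes "conformal_le h v"
  shows "conformal_le (v - h) v"
  using assms unfolding conformal_le_iff by force

lemma conformal_norm1_eq:
  fixes x y :: "int vec"
  assumes "conformal_le x y" and "norm1 y \<le> norm1 x"
  shows "x = y"
proof -
  have "norm1 (y - x) = 0" using norm1_conformal_diff[OF assms(1)] assms(2) by simp
  then show ?thesis
    using assms(1) unfolding norm1_eq_0_iff conformal_le_iff by (auto simp: vec_eq_iff)
qed

lemma Graver_below: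
  assumes "v \<in> nonzero_kernel M"
  obtains h where "h \<in> Graver M" "conformal_le h v"
proof -
  obtain h where h: "h \<in> nonzero_kernel M" "conformal_le h v"
    and least: "\<And>y. y \<in> nonzero_kernel M \<Longrightarrow> conformal_le y v \<Longrightarrow> norm1 h \<le> norm1 y"
    using ex_has_least_nat[of "\<lambda>y. y \<in> nonzero_kernel M \<and> conformal_le y v" v norm1] assms
    unfolding conformal_le_iff by force
  have "y = h" if "y \<in> nonzero_kernel M" "conformal_le y h" for y
    using conformal_norm1_eq[OF that(2)] least[OF that(1) conformal_le_trans[OF that(2) h(2)]] .
  with h show ?thesis by (intro that) (auto simp: Graver_def)
qed

lemma finite_Graver: "finite (Graver M)"
proof (rule dickson)
  let ?N = "dim_col M"
  let ?e = "\<lambda>x (i, pos). nat (if pos then x $ i else - (x $ i))"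
  show "finite ({..<?N} \<times> (UNIV :: bool set))" by simp
  fix x y assume xy: "x \<in> Graver M" "y \<in> Graver M"
    and le: "\<forall>i\<in>{..<?N} \<times> (UNIV :: bool set). ?e x i \<le> ?e y i"
  have dims: "dim_vec x = ?N" "dim_vec y = ?N"
    using xy by (auto simp: Graver_def nonzero_kernel_def)
  have "0 \<le> x $ i \<and> x $ i \<le> y $ i \<or> y $ i \<le> x $ i \<and> x $ i \<le> 0" if "i < ?N" for i
    using that le[rule_format, of "(i, True)"] le[rule_format, of "(i, False)"] by auto
  then have "conformal_le x y" unfolding conformal_le_iff using dims by auto
  with xy show "x = y" by (auto simp: Graver_def)
qed

lemma Graver_decomposition:
  assumes "v \<in> carrier_vec (dim_col M)" and "M *\<^sub>v v = 0\<^sub>v (dim_row M)"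
  shows "\<exists>\<mu>. (\<forall>h. \<mu> h > 0 \<longrightarrow> h \<in> Graver M \<and> conformal_le h v) \<and>
    (\<forall>j < dim_col M. v $ j = (\<Sum>h\<in>Graver M. int (\<mu> h) * h $ j))"
  using assms
proof (induction "norm1 v" arbitrary: v rule: less_induct)
  case less
  show ?case
  proof (cases "v = 0\<^sub>v (dim_col M)")
    case True
    then show ?thesis by (intro exI[of _ "\<lambda>_. 0"]) auto
  next
    case False
    with less.prems have "v \<in> nonzero_kernel M" by (auto simp: nonzero_kernel_def)
    then obtain h where h: "h \<in> Graver M" "conformal_le h v" by (rule Graver_below)
    have hk: "h \<in> carrier_vec (dim_col M)" "M *\<^sub>v h = 0\<^sub>v (dim_row M)" "h \<noteq> 0\<^sub>v (dim_col M)"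
      using h(1) by (auto simp: Graver_def nonzero_kernel_def)
    have "norm1 h \<noteq> 0" using hk norm1_eq_0_iff[of h] by auto
    then have "norm1 (v - h) < norm1 v" using norm1_conformal_diff[OF h(2)] by linarith
    moreover have "M *\<^sub>v (v - h) = 0\<^sub>v (dim_row M)"
      using less.prems hk by (subst mult_minus_distrib_mat_vec[of _ "dim_row M" "dim_col M"]) auto
    ultimately obtain \<mu> where \<mu>: "\<And>h'. \<mu> h' > 0 \<Longrightarrow> h' \<in> Graver M \<and> conformal_le h' (v - h)"
      "\<And>j. j < dim_col M \<Longrightarrow> (v - h) $ j = (\<Sum>h'\<in>Graver M. int (\<mu> h') * h' $ j)"
      using less.hyps[of "v - h"] less.prems hk by auto
    have "v $ j = (\<Sum>h'\<in>Graver M. int ((\<mu>(h := \<mu> h + 1)) h') * h' $ j)" if "j < dim_col M" for j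
    proof -
      have "(\<Sum>h'\<in>Graver M. int ((\<mu>(h := \<mu> h + 1)) h') * h' $ j) =
          (\<Sum>h'\<in>Graver M. int (\<mu> h') * h' $ j + (if h' = h then h $ j else 0))"
        by (intro sum.cong) (auto simp: algebra_simps)
      also have "\<dots> = (v - h) $ j + h $ j"
        using \<mu>(2)[OF that] h(1) finite_Graver[of M] by (simp add: sum.distrib)
      finally show ?thesis using that less.prems hk by auto
    qed
    moreover have "(\<mu>(h := \<mu> h + 1)) h' > 0 \<longrightarrow> h' \<in> Graver M \<and> conformal_le h' v" for h'
      using \<mu>(1)[of h'] h conformal_le_trans[OF _ conformal_diff[OF h(2)]] by auto
    ultimately show ?thesis by blast
  qed
qed

section \<open>Graver bases of n-fold products\<close>

lemma sum_nat_blocks: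
  fixes n t :: nat
  shows "(\<Sum>k<n * t. q k) = (\<Sum>p<n. \<Sum>j<t. q (p * t + j))"
proof -
  have "(\<Sum>k<n * t. q k) = (\<Sum>p<n. sum q {p * t..<p * t + t})"
    by (simp add: sum.nat_group)
  also have "\<dots> = (\<Sum>p<n. \<Sum>j<t. q (p * t + j))"
    using sum.shift_bounds_nat_ivl[of q 0 "_ * t" t] by (simp add: atLeast0LessThan add.commute)
  finally show ?thesis .
qed

definition annihilates :: "int mat \<Rightarrow> nat set \<Rightarrow> nat \<Rightarrow> (nat \<Rightarrow> int) \<Rightarrow> bool" where
  "annihilates A I t z \<longleftrightarrow> (\<forall>i\<in>I. (\<Sum>j<t. A $$ (i, j) * z j) = 0)"

lemma nfold_mult_upper:
  assumes "A \<in> carrier_mat (r + s) t" and "g \<in> carrier_vec (n * t)" and "i < r"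
  shows "(nfold r s t A n *\<^sub>v g) $ i = (\<Sum>j<t. A $$ (i, j) * (\<Sum>p<n. g $ (p * t + j)))"
proof -
  have "(nfold r s t A n *\<^sub>v g) $ i = (\<Sum>k<n * t. A $$ (i, k mod t) * g $ k)"
  proof -
    have "k mod t < t" if "k < n * t" for k using that by (cases t) auto
    then show ?thesis
      using assms
      by (auto simp: nfold_def scalar_prod_def upper_block_def atLeast0LessThan intro!: sum.cong)
  qed
  also have "\<dots> = (\<Sum>p<n. \<Sum>j<t. A $$ (i, j) * g $ (p * t + j))"
    unfolding sum_nat_blocks by (intro sum.cong refl) auto
  also have "\<dots> = (\<Sum>j<t. A $$ (i, j) * (\<Sum>p<n. g $ (p * t + j)))"
    by (subst sum.swap) (simp add: sum_distrib_left)
  finally show ?thesis .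
qed

lemma nfold_mult_lower:
  assumes "A \<in> carrier_mat (r + s) t" and "g \<in> carrier_vec (n * t)" and "p < n" and "i < s"
  shows "(nfold r s t A n *\<^sub>v g) $ (r + p * s + i) = (\<Sum>j<t. A $$ (r + i, j) * g $ (p * t + j))"
proof -
  have row: "r + p * s + i < r + n * s"
  proof -
    have "(p + 1) * s \<le> n * s" using assms(3) by (intro mult_le_mono1) auto
    then show ?thesis using assms(4) by simp
  qed
  have div: "(r + p * s + i - r) div s = p" "(r + p * s + i - r) mod s = i" using assms(4) by auto
  have "(nfold r s t A n *\<^sub>v g) $ (r + p * s + i) =
      (\<Sum>k<n * t. nfold r s t A n $$ (r + p * s + i, k) * g $ k)"
    using row assms(2) by (auto simp: nfold_def scalar_prod_def atLeast0LessThan intro!: sum.cong)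
  also have "\<dots> = (\<Sum>q<n. \<Sum>j<t. nfold r s t A n $$ (r + p * s + i, q * t + j) * g $ (q * t + j))"
    by (rule sum_nat_blocks)
  also have "\<dots> = (\<Sum>q<n. \<Sum>j<t. if q = p then A $$ (r + i, j) * g $ (p * t + j) else 0)"
  proof (intro sum.cong refl)
    fix q j assume "q \<in> {..<n}" "j \<in> {..<t}"
    moreover have "q * t + j < n * t"
    proof -
      have "(q + 1) * t \<le> n * t" using \<open>q \<in> {..<n}\<close> by (intro mult_le_mono1) auto
      then show ?thesis using \<open>j \<in> {..<t}\<close> by simp
    qed
    ultimately show "nfold r s t A n $$ (r + p * s + i, q * t + j) * g $ (q * t + j) =
        (if q = p then A $$ (r + i, j) * g $ (p * t + j) else 0)"
      using row div assms by (auto simp: nfold_def lower_block_def)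
  qed
  also have "\<dots> = (\<Sum>q<n. if q = p then \<Sum>j<t. A $$ (r + i, j) * g $ (p * t + j) else 0)"
    by (intro sum.cong refl) auto
  also have "\<dots> = (\<Sum>j<t. A $$ (r + i, j) * g $ (p * t + j))"
    using assms(3) by simp
  finally show ?thesis .
qed

lemma nfold_row_cases:
  fixes k r s n :: nat
  assumes "k < r + n * s"
  obtains "k < r" | p i where "p < n" "i < s" "k = r + p * s + i"
proof (cases "k < r")
  case False
  with assms have "k - r < n * s" by simp
  then have "s > 0" by (cases s) auto
  then have "(k - r) div s < n" "(k - r) mod s < s"
    using \<open>k - r < n * s\<close> by (auto simp: less_mult_imp_div_less)
  then show ?thesis using that(2)[of "(k - r) div s" "(k - r) mod s"] False by simp
qed (use that in auto)

lemma nfold_kernel_iff: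
  assumes "A \<in> carrier_mat (r + s) t" and "g \<in> carrier_vec (n * t)"
  shows "nfold r s t A n *\<^sub>v g = 0\<^sub>v (r + n * s) \<longleftrightarrow>
    annihilates A {..<r} t (\<lambda>j. \<Sum>p<n. g $ (p * t + j)) \<and>
    (\<forall>p<n. annihilates A {r..<r + s} t (\<lambda>j. g $ (p * t + j)))" (is "?L \<longleftrightarrow> ?R")
proof
  assume L: ?L
  have "annihilates A {..<r} t (\<lambda>j. \<Sum>p<n. g $ (p * t + j))"
    unfolding annihilates_def using nfold_mult_upper[OF assms] L by auto
  moreover have "annihilates A {r..<r + s} t (\<lambda>j. g $ (p * t + j))" if "p < n" for p
    unfolding annihilates_def
  proof
    fix i assume i: "i \<in> {r..<r + s}"
    have "(p + 1) * s \<le> n * s" using that by (intro mult_le_mono1) auto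
    then have "r + p * s + (i - r) < r + n * s" using i by auto
    then show "(\<Sum>j<t. A $$ (i, j) * g $ (p * t + j)) = 0"
      using nfold_mult_lower[OF assms that, of "i - r"] L i by auto
  qed
  ultimately show ?R by blast
next
  assume R: ?R
  show ?L
  proof
    fix k assume k: "k < dim_vec (0\<^sub>v (r + n * s))"
    then have "k < r + n * s" by simp
    then show "(nfold r s t A n *\<^sub>v g) $ k = 0\<^sub>v (r + n * s) $ k"
    proof (cases rule: nfold_row_cases)
      case 1
      then show ?thesis using nfold_mult_upper[OF assms 1] R k by (simp add: annihilates_def)
    next
      case (2 p i)
      then show ?thesis using nfold_mult_lower[OF assms 2(1,2)] R k by (simp add: annihilates_def)
    qed
  qed (simp add: nfold_def)
qed

lemma lower_block_kernel_iff:
  assumes "A \<in> carrier_mat (r + s) t"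
  shows "lower_block r s A *\<^sub>v vec t z = 0\<^sub>v s \<longleftrightarrow> annihilates A {r..<r + s} t z"
proof -
  have "(lower_block r s A *\<^sub>v vec t z) $ i = (\<Sum>j<t. A $$ (r + i, j) * z j)" if "i < s" for i
    using that assms by (auto simp: lower_block_def scalar_prod_def atLeast0LessThan intro!: sum.cong)
  moreover have "dim_vec (lower_block r s A *\<^sub>v vec t z) = s" by (simp add: lower_block_def)
  ultimately have "lower_block r s A *\<^sub>v vec t z = 0\<^sub>v s \<longleftrightarrow>
      (\<forall>i<s. (\<Sum>j<t. A $$ (r + i, j) * z j) = 0)"
    by (auto simp: vec_eq_iff)
  also have "\<dots> \<longleftrightarrow> annihilates A {r..<r + s} t z"
    unfolding annihilates_def
    by (metis add_less_cancel_left atLeastLessThan_iff le_add1 le_add_diff_inverse)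
  finally show ?thesis .
qed

lemma bounded_split_of_sum:
  fixes a :: "nat \<Rightarrow> nat"
  assumes "m \<le> (\<Sum>p<n. a p)"
  shows "\<exists>c. (\<forall>p<n. c p \<le> a p) \<and> (\<Sum>p<n. c p) = m"
  using assms
proof (induction n arbitrary: m)
  case (Suc n)
  obtain c where c: "\<forall>p<n. c p \<le> a p" "(\<Sum>p<n. c p) = min m (\<Sum>p<n. a p)"
    using Suc.IH[of "min m (\<Sum>p<n. a p)"] by auto
  have "(\<Sum>p<n. (c(n := m - min m (\<Sum>p<n. a p))) p) = (\<Sum>p<n. c p)"
    by (intro sum.cong) auto
  then show ?case
    using c Suc.prems by (intro exI[of _ "c(n := m - min m (\<Sum>p<n. a p))"]) auto
qed simp

lemma conformal_subcombination:
  fixes \<mu> c :: "'a \<Rightarrow> nat" and d :: "'a \<Rightarrow> int"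
  assumes "finite G"
    and sign: "\<And>h. h \<in> G \<Longrightarrow> \<mu> h > 0 \<Longrightarrow> 0 \<le> d h \<and> d h \<le> w \<or> w \<le> d h \<and> d h \<le> 0"
    and w: "w = (\<Sum>h\<in>G. int (\<mu> h) * d h)"
    and le: "\<And>h. h \<in> G \<Longrightarrow> c h \<le> \<mu> h"
  defines "w' \<equiv> \<Sum>h\<in>G. int (c h) * d h"
  shows "0 \<le> w' \<and> w' \<le> w \<or> w \<le> w' \<and> w' \<le> 0"
    and "w' = 0 \<Longrightarrow> h \<in> G \<Longrightarrow> int (c h) * d h = 0"
proof -
  have pos: "0 \<le> int (c h) * d h \<and> int (c h) * d h \<le> int (\<mu> h) * d h" if "0 \<le> w" "h \<in> G" for h
  proof (cases "\<mu> h = 0")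
    case False
    then have "0 \<le> d h" using sign[OF that(2)] that(1) by auto
    then show ?thesis using le[OF that(2)] by (auto intro: mult_right_mono)
  qed (use le[OF that(2)] in auto)
  have neg: "int (c h) * d h \<le> 0 \<and> int (\<mu> h) * d h \<le> int (c h) * d h" if "w \<le> 0" "h \<in> G" for h
  proof (cases "\<mu> h = 0")
    case False
    then have "d h \<le> 0" using sign[OF that(2)] that(1) by auto
    then show ?thesis using le[OF that(2)] by (auto intro: mult_right_mono_neg simp: mult_nonneg_nonpos)
  qed (use le[OF that(2)] in auto)
  show "0 \<le> w' \<and> w' \<le> w \<or> w \<le> w' \<and> w' \<le> 0"
  proof (cases "0 \<le> w")
    case True
    then show ?thesis using pos unfolding w'_def w by (auto intro: sum_nonneg sum_mono)
  next
    case False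
    then have "w \<le> 0" by simp
    then show ?thesis using neg unfolding w'_def w by (auto intro: sum_nonpos sum_mono)
  qed
  show "int (c h) * d h = 0" if "w' = 0" "h \<in> G"
  proof (cases "0 \<le> w")
    case True
    then show ?thesis
      using sum_nonneg_eq_0_iff[of G "\<lambda>h. int (c h) * d h"] pos that assms(1) unfolding w'_def by auto
  next
    case False
    then have "w \<le> 0" by simp
    then show ?thesis
      using sum_nonneg_eq_0_iff[of G "\<lambda>h. - (int (c h) * d h)"] neg that assms(1)
      unfolding w'_def by (auto simp: sum_negf)
  qed
qed

definition combination :: "int vec set \<Rightarrow> (int vec \<Rightarrow> nat) \<Rightarrow> nat \<Rightarrow> int" where
  "combination G \<mu> j = (\<Sum>h\<in>G. int (\<mu> h) * h $ j)"

definition null_multiplicities :: "int mat \<Rightarrow> nat \<Rightarrow> nat \<Rightarrow> int vec set \<Rightarrow> (int vec \<Rightarrow> nat) set" where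
  "null_multiplicities A r t G = {\<mu>. (\<forall>h. h \<notin> G \<longrightarrow> \<mu> h = 0) \<and> (\<exists>h\<in>G. \<mu> h \<noteq> 0) \<and>
     annihilates A {..<r} t (combination G \<mu>)}"

definition minimal_multiplicities :: "int mat \<Rightarrow> nat \<Rightarrow> nat \<Rightarrow> int vec set \<Rightarrow> (int vec \<Rightarrow> nat) set" where
  "minimal_multiplicities A r t G = {\<mu> \<in> null_multiplicities A r t G.
     \<forall>\<nu> \<in> null_multiplicities A r t G. \<nu> \<le> \<mu> \<longrightarrow> \<nu> = \<mu>}"

lemma finite_minimal_multiplicities:
  assumes "finite G"
  shows "finite (minimal_multiplicities A r t G)"
proof (rule dickson[where e = "\<lambda>\<mu>. \<mu>"])
  show "finite G" by fact
  fix \<mu> \<nu> assume *: "\<mu> \<in> minimal_multiplicities A r t G" "\<nu> \<in> minimal_multiplicities A r t G"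
    and le: "\<forall>i\<in>G. \<mu> i \<le> \<nu> i"
  have "\<mu> \<le> \<nu>"
  proof (rule le_funI)
    fix h show "\<mu> h \<le> \<nu> h"
      using * le by (cases "h \<in> G") (auto simp: minimal_multiplicities_def null_multiplicities_def)
  qed
  with * show "\<mu> = \<nu>" by (auto simp: minimal_multiplicities_def)
qed

lemma minimal_multiplicities_below:
  assumes "finite G" and "\<mu> \<in> null_multiplicities A r t G"
  obtains \<nu> where "\<nu> \<in> minimal_multiplicities A r t G" "\<nu> \<le> \<mu>"
proof -
  obtain \<nu> where \<nu>: "\<nu> \<in> null_multiplicities A r t G" "\<nu> \<le> \<mu>"
    and least: "\<And>\<kappa>. \<kappa> \<in> null_multiplicities A r t G \<Longrightarrow> \<kappa> \<le> \<mu> \<Longrightarrow> sum \<nu> G \<le> sum \<kappa> G"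
    using ex_has_least_nat[of "\<lambda>\<nu>. \<nu> \<in> null_multiplicities A r t G \<and> \<nu> \<le> \<mu>" \<mu> "\<lambda>\<nu>. sum \<nu> G"] assms(2)
    by blast
  have "\<kappa> = \<nu>" if \<kappa>: "\<kappa> \<in> null_multiplicities A r t G" "\<kappa> \<le> \<nu>" for \<kappa>
  proof
    fix h
    have "\<not> (\<exists>i\<in>G. \<kappa> i < \<nu> i)"
      using sum_strict_mono_ex1[OF assms(1), of \<kappa> \<nu>] least[OF \<kappa>(1) order_trans[OF \<kappa>(2) \<nu>(2)]] \<kappa>(2)
      by (auto simp: le_fun_def)
    then show "\<kappa> h = \<nu> h"
      using \<kappa> \<nu>(1) by (cases "h \<in> G") (auto simp: null_multiplicities_def le_fun_def not_less intro: le_antisym)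
  qed
  with \<nu> show ?thesis by (intro that) (auto simp: minimal_multiplicities_def)
qed

lemma block_index_less:
  fixes p j n t :: nat
  assumes "p < n" and "j < t"
  shows "p * t + j < n * t"
proof -
  have "(p + 1) * t \<le> n * t" using assms(1) by (intro mult_le_mono1) auto
  then show ?thesis using assms(2) by simp
qed

lemma annihilates_cong:
  assumes "\<And>j. j < t \<Longrightarrow> z j = z' j"
  shows "annihilates A I t z \<longleftrightarrow> annihilates A I t z'"
  using assms by (simp add: annihilates_def)

lemma dim_nfold [simp]:
  "dim_row (nfold r s t A n) = r + n * s" "dim_col (nfold r s t A n) = n * t"
  by (simp_all add: nfold_def)

lemma annihilates_combination:
  assumes "\<And>h. h \<in> G \<Longrightarrow> annihilates A I t (\<lambda>j. h $ j)"
  shows "annihilates A I t (combination G \<mu>)"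
  unfolding annihilates_def
proof
  fix i assume i: "i \<in> I"
  have "(\<Sum>j<t. A $$ (i, j) * combination G \<mu> j) = (\<Sum>h\<in>G. int (\<mu> h) * (\<Sum>j<t. A $$ (i, j) * h $ j))"
    unfolding combination_def sum_distrib_left
    by (subst sum.swap) (simp add: algebra_simps)
  also have "\<dots> = 0" using assms i by (simp add: annihilates_def)
  finally show "(\<Sum>j<t. A $$ (i, j) * combination G \<mu> j) = 0" .
qed

text \<open>If the multiplicities of all parts of the bricks of \<open>g\<close> are cut down to a minimal null
  multiplicity vector, the parts that remain form a nonzero kernel element conformal to \<open>g\<close>; if
  \<open>g\<close> is in the Graver basis, it is \<open>g\<close> itself.\<close>
lemma Graver_nfold_combination:
  assumes A: "A \<in> carrier_mat (r + s) t" and g: "g \<in> Graver (nfold r s t A n)"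
  defines "G \<equiv> Graver (lower_block r s A)"
  obtains c :: "nat \<Rightarrow> int vec \<Rightarrow> nat"
    where "\<And>p j. p < n \<Longrightarrow> j < t \<Longrightarrow> g $ (p * t + j) = combination G (c p) j"
      and "(\<lambda>h. \<Sum>p<n. c p h) \<in> minimal_multiplicities A r t G"
proof -
  have finG: "finite G" unfolding G_def by (rule finite_Graver)
  have dimL: "dim_row (lower_block r s A) = s" "dim_col (lower_block r s A) = t"
    using A by (auto simp: lower_block_def)
  have gv: "g \<in> carrier_vec (n * t)" and g0: "g \<noteq> 0\<^sub>v (n * t)"
    and gk: "nfold r s t A n *\<^sub>v g = 0\<^sub>v (r + n * s)"
    using g by (auto simp: Graver_def nonzero_kernel_def)
  have upper: "annihilates A {..<r} t (\<lambda>j. \<Sum>p<n. g $ (p * t + j))"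
    and lower: "\<And>p. p < n \<Longrightarrow> annihilates A {r..<r + s} t (\<lambda>j. g $ (p * t + j))"
    using nfold_kernel_iff[OF A gv] gk by auto
  have "\<forall>p. p < n \<longrightarrow> (\<exists>\<mu>. (\<forall>h. \<mu> h > 0 \<longrightarrow> h \<in> G \<and> conformal_le h (vec t (\<lambda>j. g $ (p * t + j)))) \<and>
      (\<forall>j<t. g $ (p * t + j) = combination G \<mu> j))"
  proof (intro allI impI)
    fix p assume "p < n"
    then have "lower_block r s A *\<^sub>v vec t (\<lambda>j. g $ (p * t + j)) = 0\<^sub>v s"
      using lower lower_block_kernel_iff[OF A] by simp
    then show "\<exists>\<mu>. (\<forall>h. \<mu> h > 0 \<longrightarrow> h \<in> G \<and> conformal_le h (vec t (\<lambda>j. g $ (p * t + j)))) \<and>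
      (\<forall>j<t. g $ (p * t + j) = combination G \<mu> j)"
      using Graver_decomposition[of "vec t (\<lambda>j. g $ (p * t + j))" "lower_block r s A"]
      unfolding G_def combination_def dimL by auto
  qed
  then obtain \<mu> where \<mu>: "\<And>p h. p < n \<Longrightarrow> \<mu> p h > 0 \<Longrightarrow> h \<in> G \<and> conformal_le h (vec t (\<lambda>j. g $ (p * t + j)))"
    "\<And>p j. p < n \<Longrightarrow> j < t \<Longrightarrow> g $ (p * t + j) = combination G (\<mu> p) j"
    by metis
  have sum_comb: "(\<Sum>p<n. combination G (q p) j) = combination G (\<lambda>h. \<Sum>p<n. q p h) j" for q j
    unfolding combination_def by (subst sum.swap) (simp add: sum_distrib_right)
  have "(\<lambda>h. \<Sum>p<n. \<mu> p h) \<in> null_multiplicities A r t G"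
  proof -
    have "annihilates A {..<r} t (combination G (\<lambda>h. \<Sum>p<n. \<mu> p h))"
      using upper \<mu>(2) by (subst annihilates_cong) (auto simp flip: sum_comb)
    moreover have "\<exists>h\<in>G. (\<Sum>p<n. \<mu> p h) \<noteq> 0"
    proof (rule ccontr)
      assume "\<not> ?thesis"
      then have "\<And>p h. p < n \<Longrightarrow> h \<in> G \<Longrightarrow> \<mu> p h = 0" by auto
      then have zero: "\<And>p j. p < n \<Longrightarrow> j < t \<Longrightarrow> g $ (p * t + j) = 0"
        using \<mu>(2) by (simp add: combination_def)
      have "g $ k = 0" if "k < n * t" for k
      proof -
        have "k div t < n" "k mod t < t"
          using that by (auto simp: less_mult_imp_div_less) (cases t; auto)
        then show ?thesis using zero[of "k div t" "k mod t"] by simp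
      qed
      with g0 gv show False by auto
    qed
    moreover have "(\<Sum>p<n. \<mu> p h) = 0" if "h \<notin> G" for h
      using \<mu>(1) that by fastforce
    ultimately show ?thesis unfolding null_multiplicities_def by blast
  qed
  then obtain \<nu> where \<nu>: "\<nu> \<in> minimal_multiplicities A r t G" "\<nu> \<le> (\<lambda>h. \<Sum>p<n. \<mu> p h)"
    using minimal_multiplicities_below[OF finG] by blast
  have "\<forall>h. \<exists>c. (\<forall>p<n. c p \<le> \<mu> p h) \<and> (\<Sum>p<n. c p) = \<nu> h"
    using bounded_split_of_sum \<nu>(2) by (simp add: le_fun_def)
  then obtain c' where c': "\<And>h p. p < n \<Longrightarrow> c' h p \<le> \<mu> p h" "\<And>h. (\<Sum>p<n. c' h p) = \<nu> h"
    by metis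
  define c where "c = (\<lambda>p h. c' h p)"
  have c: "\<And>h p. p < n \<Longrightarrow> c p h \<le> \<mu> p h" and c\<nu>: "(\<lambda>h. \<Sum>p<n. c p h) = \<nu>"
    using c' by (auto simp: c_def)
  define g' where "g' = vec (n * t) (\<lambda>k. combination G (c (k div t)) (k mod t))"
  have g'_entry: "g' $ (p * t + j) = combination G (c p) j" if "p < n" "j < t" for p j
    using block_index_less[OF that] that by (simp add: g'_def)
  have sign: "0 \<le> h $ j \<and> h $ j \<le> g $ (p * t + j) \<or> g $ (p * t + j) \<le> h $ j \<and> h $ j \<le> 0"
    if "p < n" "j < t" "h \<in> G" "\<mu> p h > 0" for p j h
    using \<mu>(1)[OF that(1,4)] that(2) by (auto simp: conformal_le_iff)
  note sub = conformal_subcombination[where G = G, OF finG sign \<mu>(2)[unfolded combination_def] c]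
  have conf: "conformal_le g' g"
    unfolding conformal_le_iff
  proof (intro conjI allI impI)
    fix k assume "k < dim_vec g'"
    then have k: "k < n * t" by (simp add: g'_def)
    then have kk: "k div t < n" "k mod t < t"
      by (auto simp: less_mult_imp_div_less) (cases t; auto)
    then show "0 \<le> g' $ k \<and> g' $ k \<le> g $ k \<or> g $ k \<le> g' $ k \<and> g' $ k \<le> 0"
      using sub(1)[OF kk(1) kk(2) _ _ kk kk(1)] g'_entry[OF kk] by (simp add: combination_def)
  qed (use gv in \<open>simp add: g'_def\<close>)
  have "g' \<noteq> 0\<^sub>v (n * t)"
  proof
    assume z: "g' = 0\<^sub>v (n * t)"
    obtain h where h: "h \<in> G" "\<nu> h \<noteq> 0"
      using \<nu>(1) by (auto simp: minimal_multiplicities_def null_multiplicities_def)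
    then have "(\<Sum>p<n. c p h) \<noteq> 0" using fun_cong[OF c\<nu>, of h] by simp
    then obtain p where p: "p < n" "c p h \<noteq> 0" by auto
    have "h $ j = 0" if "j < t" for j
    proof -
      have "combination G (c p) j = 0"
        using g'_entry[OF p(1) that] z block_index_less[OF p(1) that] by simp
      then show ?thesis
        using sub(2)[OF p(1) that _ _ p(1) that p(1) _ h(1)] p(2) by (simp add: combination_def)
    qed
    then show False using h(1) dimL by (auto simp: G_def Graver_def nonzero_kernel_def)
  qed
  moreover have "nfold r s t A n *\<^sub>v g' = 0\<^sub>v (r + n * s)"
  proof -
    have hk: "annihilates A {r..<r + s} t (\<lambda>j. h $ j)" if "h \<in> G" for h
    proof -
      have "lower_block r s A *\<^sub>v vec t (\<lambda>j. h $ j) = 0\<^sub>v s" "dim_vec h = t"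
        using that dimL by (auto simp: G_def Graver_def nonzero_kernel_def)
          (metis carrier_vecD eq_vecI index_vec dim_vec)
      then show ?thesis using lower_block_kernel_iff[OF A] by simp
    qed
    have "annihilates A {r..<r + s} t (\<lambda>j. g' $ (p * t + j))" if "p < n" for p
      using annihilates_combination[OF hk] g'_entry[OF that] by (subst annihilates_cong) auto
    moreover have "annihilates A {..<r} t (\<lambda>j. \<Sum>p<n. g' $ (p * t + j))"
    proof (subst annihilates_cong)
      show "annihilates A {..<r} t (combination G \<nu>)"
        using \<nu>(1) by (auto simp: minimal_multiplicities_def null_multiplicities_def)
      show "(\<Sum>p<n. g' $ (p * t + j)) = combination G \<nu> j" if "j < t" for j
        using g'_entry that sum_comb[of c j] by (simp add: c\<nu>)
    qed
    ultimately show ?thesis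
      using nfold_kernel_iff[OF A, of g' n] by (simp add: g'_def)
  qed
  ultimately have "g' \<in> nonzero_kernel (nfold r s t A n)"
    by (auto simp: nonzero_kernel_def g'_def)
  then have "g' = g" using g conf by (auto simp: Graver_def)
  then show thesis using that[of c] g'_entry c\<nu> \<nu>(1) by simp
qed

lemma Graver_nfold_partial_sums_bounded:
  assumes A: "A \<in> carrier_mat (r + s) t"
  obtains B :: int where "\<And>n g m j. g \<in> Graver (nfold r s t A n) \<Longrightarrow> m \<le> n \<Longrightarrow> j < t \<Longrightarrow>
    \<bar>\<Sum>p<m. g $ (p * t + j)\<bar> \<le> B"
proof
  let ?G = "Graver (lower_block r s A)"
  let ?S = "minimal_multiplicities A r t ?G"
  define w where "w \<mu> j = (\<Sum>h\<in>?G. int (\<mu> h) * \<bar>h $ j\<bar>)" for \<mu> j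
  have w_nonneg: "0 \<le> w \<mu> j" for \<mu> j by (auto simp: w_def intro: sum_nonneg)
  fix n g m j assume g: "g \<in> Graver (nfold r s t A n)" and "m \<le> n" "j < t"
  obtain c where c: "\<And>p j. p < n \<Longrightarrow> j < t \<Longrightarrow> g $ (p * t + j) = combination ?G (c p) j"
    "(\<lambda>h. \<Sum>p<n. c p h) \<in> ?S"
    using Graver_nfold_combination[OF A g] by metis
  have "\<bar>\<Sum>p<m. g $ (p * t + j)\<bar> \<le> (\<Sum>p<m. \<bar>g $ (p * t + j)\<bar>)" by (rule sum_abs)
  also have "\<dots> \<le> (\<Sum>p<n. \<bar>g $ (p * t + j)\<bar>)" using \<open>m \<le> n\<close> by (intro sum_mono2) auto
  also have "\<dots> \<le> (\<Sum>p<n. w (c p) j)"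
  proof (rule sum_mono)
    fix p assume "p \<in> {..<n}"
    then show "\<bar>g $ (p * t + j)\<bar> \<le> w (c p) j"
      using c(1)[of p j] \<open>j < t\<close> sum_abs[of "\<lambda>h. int (c p h) * h $ j" ?G]
      by (simp add: combination_def w_def abs_mult)
  qed
  also have "\<dots> = w (\<lambda>h. \<Sum>p<n. c p h) j"
    unfolding w_def by (subst sum.swap) (simp add: sum_distrib_right)
  also have "\<dots> \<le> (\<Sum>j<t. w (\<lambda>h. \<Sum>p<n. c p h) j)"
    using \<open>j < t\<close> w_nonneg by (intro member_le_sum) auto
  also have "\<dots> \<le> (\<Sum>\<mu>\<in>?S. \<Sum>j<t. w \<mu> j)"
    using c(2) finite_minimal_multiplicities[OF finite_Graver] w_nonneg
    by (intro member_le_sum[of _ ?S "\<lambda>\<mu>. \<Sum>j<t. w \<mu> j"]) (auto intro: sum_nonneg)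
  finally show "\<bar>\<Sum>p<m. g $ (p * t + j)\<bar> \<le> (\<Sum>\<mu>\<in>?S. \<Sum>j<t. w \<mu> j)" .
qed

section \<open>Graver steps and separable convex functions\<close>

lemma convex_on_conformal_split:
  fixes \<phi> :: "real \<Rightarrow> real"
  assumes "convex_on UNIV \<phi>" and "0 \<le> a \<and> a \<le> d \<or> d \<le> a \<and> a \<le> 0"
  shows "\<phi> (x + a) + \<phi> (x + d - a) \<le> \<phi> x + \<phi> (x + d)"
proof (cases "d = 0")
  case False
  define q where "q = a / d"
  have q: "0 \<le> q" "q \<le> 1" and a: "a = q * d"
    using assms(2) False by (auto simp: q_def divide_simps)
  have "\<phi> ((1 - q) *\<^sub>R x + q *\<^sub>R (x + d)) \<le> (1 - q) * \<phi> x + q * \<phi> (x + d)"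
    using convex_onD[OF assms(1)] q by simp
  moreover have "\<phi> ((1 - (1 - q)) *\<^sub>R x + (1 - q) *\<^sub>R (x + d)) \<le> (1 - (1 - q)) * \<phi> x + (1 - q) * \<phi> (x + d)"
    using q by (intro convex_onD[OF assms(1)]) auto
  moreover have "(1 - q) *\<^sub>R x + q *\<^sub>R (x + d) = x + a"
    "(1 - (1 - q)) *\<^sub>R x + (1 - q) *\<^sub>R (x + d) = x + d - a"
    by (simp_all add: a algebra_simps)
  ultimately show ?thesis by (simp add: algebra_simps)
qed (use assms in auto)

lemma separable_convex_conformal_split:
  assumes "separable_convex n t f" and "x \<in> carrier_vec (n * t)" and "g \<in> carrier_vec (n * t)"
    and "conformal_le h g"
  shows "at_int f (x + h) + at_int f (x + g - h) \<le> at_int f x + at_int f (x + g)"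
proof -
  obtain \<phi> where \<phi>: "\<And>i j. i < n \<Longrightarrow> j < t \<Longrightarrow> convex_on UNIV (\<phi> i j)"
    and f: "\<And>x. x \<in> carrier_vec (n * t) \<Longrightarrow> f x = (\<Sum>i<n. \<Sum>j<t. \<phi> i j (x $ (i * t + j)))"
    using assms(1) unfolding separable_convex_def by blast
  have h: "h \<in> carrier_vec (n * t)"
    using assms(3,4) by (auto simp: conformal_le_def intro!: carrier_vecI)
  have F: "at_int f y = (\<Sum>i<n. \<Sum>j<t. \<phi> i j (real_of_int (y $ (i * t + j))))"
    if "y \<in> carrier_vec (n * t)" for y
    using that f[of "map_vec real_of_int y"] block_index_less by auto
  have "\<phi> i j (real_of_int ((x + h) $ (i * t + j))) + \<phi> i j (real_of_int ((x + g - h) $ (i * t + j)))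
      \<le> \<phi> i j (real_of_int (x $ (i * t + j))) + \<phi> i j (real_of_int ((x + g) $ (i * t + j)))"
    if "i < n" "j < t" for i j
  proof -
    let ?k = "i * t + j"
    have "0 \<le> h $ ?k \<and> h $ ?k \<le> g $ ?k \<or> g $ ?k \<le> h $ ?k \<and> h $ ?k \<le> 0"
      using assms(3,4) h block_index_less[OF that] unfolding conformal_le_iff by auto
    then show ?thesis
      using convex_on_conformal_split[OF \<phi>[OF that], of "real_of_int (h $ ?k)" "real_of_int (g $ ?k)"
          "real_of_int (x $ ?k)"] block_index_less[OF that] assms(2,3) h
      by auto
  qed
  then show ?thesis
    using assms(2,3) h by (simp add: F flip: sum.distrib) (intro sum_mono, auto)
qed

lemma Graver_augmentation:
  assumes "separable_convex n t f" and "dim_col M = n * t"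
    and "feasible M b l u x" and "feasible M b l u y" and "at_int f y < at_int f x"
  shows "\<exists>h\<in>Graver M. feasible_step M b l u x h \<and> at_int f (x + h) < at_int f x"
  using assms(4,5)
proof (induction "norm1 (y - x)" arbitrary: y rule: less_induct)
  case less
  let ?g = "y - x"
  have x: "x \<in> carrier_vec (n * t)" "M *\<^sub>v x = b" "l \<le> x" "x \<le> u"
    and y: "y \<in> carrier_vec (n * t)" "M *\<^sub>v y = b" "l \<le> y" "y \<le> u"
    using assms(2,3) less.prems by (auto simp: feasible_def)
  have M: "M \<in> carrier_mat (dim_row M) (n * t)" using assms(2) by auto
  have b: "b \<in> carrier_vec (dim_row M)" using mult_mat_vec_carrier[OF M x(1)] x(2) by simp
  have "?g \<noteq> 0\<^sub>v (n * t)"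
  proof
    assume z: "?g = 0\<^sub>v (n * t)"
    have "y = x"
    proof
      fix k assume "k < dim_vec x"
      then have "?g $ k = 0" using z x y by auto
      then show "y $ k = x $ k" using \<open>k < dim_vec x\<close> x y by auto
    qed (use x y in auto)
    then show False using less.prems by simp
  qed
  moreover have "M *\<^sub>v ?g = 0\<^sub>v (dim_row M)"
    using x y b by (subst mult_minus_distrib_mat_vec[OF M]) auto
  ultimately have "?g \<in> nonzero_kernel M"
    using x y assms(2) by (auto simp: nonzero_kernel_def)
  then obtain h where h: "h \<in> Graver M" "conformal_le h ?g" by (rule Graver_below)
  have hv: "h \<in> carrier_vec (n * t)" "M *\<^sub>v h = 0\<^sub>v (dim_row M)" "h \<noteq> 0\<^sub>v (n * t)"
    using h(1) assms(2) by (auto simp: Graver_def nonzero_kernel_def)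
  have between: "0 \<le> h $ k \<and> x $ k + h $ k \<le> y $ k \<or> y $ k \<le> x $ k + h $ k \<and> h $ k \<le> 0"
    if "k < n * t" for k
    using h(2) that x y hv unfolding conformal_le_iff by force
  have step: "feasible_step M b l u x h"
  proof -
    have "M *\<^sub>v (x + h) = b" using x hv b by (subst mult_add_distrib_mat_vec[OF M]) auto
    moreover have "l \<le> x + h" "x + h \<le> u"
      using x y hv between unfolding less_eq_vec_def by fastforce+
    ultimately show ?thesis using x hv assms(2) by (auto simp: feasible_step_def feasible_def)
  qed
  show ?case
  proof (cases "at_int f (x + h) < at_int f x")
    case True
    with h(1) step show ?thesis by blast
  next
    case False
    have eq: "x + ?g = y" using x y by auto
    have "at_int f (x + h) + at_int f (y - h) \<le> at_int f x + at_int f y"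
      using separable_convex_conformal_split[OF assms(1) x(1) _ h(2)] x y unfolding eq by simp
    then have "at_int f (y - h) < at_int f x" using False less.prems(2) by linarith
    moreover have "feasible M b l u (y - h)"
    proof -
      have "M *\<^sub>v (y - h) = b" using y hv b by (subst mult_minus_distrib_mat_vec[OF M]) auto
      moreover have "l \<le> y - h" "y - h \<le> u"
        using x y hv between unfolding less_eq_vec_def by fastforce+
      ultimately show ?thesis using y hv assms(2) by (auto simp: feasible_def)
    qed
    moreover have "norm1 (y - h - x) < norm1 ?g"
    proof -
      have "y - h - x = ?g - h" using x y hv by auto
      moreover have "norm1 h \<noteq> 0" using hv norm1_eq_0_iff[of h] by auto
      ultimately show ?thesis using norm1_conformal_diff[OF h(2)] by simp
    qed
    ultimately show ?thesis using less.hyps by blast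
  qed
qed

section \<open>Loop-free programs\<close>

primrec loop_free :: "com \<Rightarrow> bool" where
  "loop_free Skip \<longleftrightarrow> True"
| "loop_free (Assign v e) \<longleftrightarrow> True"
| "loop_free (Store a i e) \<longleftrightarrow> True"
| "loop_free (Copy a b) \<longleftrightarrow> True"
| "loop_free (Seq c c') \<longleftrightarrow> loop_free c \<and> loop_free c'"
| "loop_free (If p c c') \<longleftrightarrow> loop_free c \<and> loop_free c'"
| "loop_free (While p c) \<longleftrightarrow> False"

primrec run :: "(array \<Rightarrow> array \<Rightarrow> bool) \<Rightarrow> com \<Rightarrow> state \<Rightarrow> state" where
  "run cmp Skip \<sigma> = \<sigma>"
| "run cmp (Assign v e) \<sigma> = State ((scalars \<sigma>)(v := aval e \<sigma>)) (arrays \<sigma>)"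
| "run cmp (Store a i e) \<sigma> =
     State (scalars \<sigma>) ((arrays \<sigma>)(a := (arrays \<sigma> a)(aval i \<sigma> := aval e \<sigma>)))"
| "run cmp (Copy a b) \<sigma> = State (scalars \<sigma>) ((arrays \<sigma>)(a := arrays \<sigma> b))"
| "run cmp (Seq c c') \<sigma> = run cmp c' (run cmp c \<sigma>)"
| "run cmp (If p c c') \<sigma> = (if bval cmp p \<sigma> then run cmp c \<sigma> else run cmp c' \<sigma>)"
| "run cmp (While p c) \<sigma> = \<sigma>"

primrec max_steps :: "com \<Rightarrow> nat" where
  "max_steps Skip = 1"
| "max_steps (Assign v e) = 1 + acost e"
| "max_steps (Store a i e) = 1 + acost i + acost e"
| "max_steps (Copy a b) = 1"
| "max_steps (Seq c c') = 1 + max_steps c + max_steps c'"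
| "max_steps (If p c c') = 1 + bcost p + max (max_steps c) (max_steps c')"
| "max_steps (While p c) = 0"

lemma exec_loop_free:
  assumes "loop_free c"
  obtains k where "exec cmp c \<sigma> k (run cmp c \<sigma>)" and "k \<le> max_steps c"
proof -
  have "\<exists>k. exec cmp c \<sigma> k (run cmp c \<sigma>) \<and> k \<le> max_steps c"
    using assms
  proof (induction c arbitrary: \<sigma>)
    case (Seq c c')
    obtain k k' where "exec cmp c \<sigma> k (run cmp c \<sigma>)" "k \<le> max_steps c"
      "exec cmp c' (run cmp c \<sigma>) k' (run cmp c' (run cmp c \<sigma>))" "k' \<le> max_steps c'"
      using Seq.IH(1)[of \<sigma>] Seq.IH(2)[of "run cmp c \<sigma>"] Seq.prems by auto
    then show ?case by (intro exI[of _ "1 + k + k'"]) (auto intro: exec.Seq[simplified])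
  next
    case (If p c c')
    show ?case
    proof (cases "bval cmp p \<sigma>")
      case True
      obtain k where "exec cmp c \<sigma> k (run cmp c \<sigma>)" "k \<le> max_steps c"
        using If.IH(1)[of \<sigma>] If.prems by auto
      with True show ?thesis
        by (intro exI[of _ "1 + bcost p + k"]) (auto intro: exec.IfTrue[simplified])
    next
      case False
      obtain k where "exec cmp c' \<sigma> k (run cmp c' \<sigma>)" "k \<le> max_steps c'"
        using If.IH(2)[of \<sigma>] If.prems by auto
      with False show ?thesis
        by (intro exI[of _ "1 + bcost p + k"]) (auto intro: exec.IfFalse[simplified])
    qed
  qed (auto intro: exec.intros[simplified])
  then show thesis using that by blast
qed

definition block :: "com list \<Rightarrow> com" where
  "block cs = foldr Seq cs Skip"

lemma loop_free_block [simp]: "loop_free (block cs) \<longleftrightarrow> (\<forall>c\<in>set cs. loop_free c)"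
  by (induction cs) (auto simp: block_def)

lemma run_block [simp]:
  "run cmp (block []) \<sigma> = \<sigma>"
  "run cmp (block (c # cs)) \<sigma> = run cmp (block cs) (run cmp c \<sigma>)"
  by (simp_all add: block_def)

lemma run_block_append [simp]:
  "run cmp (block (cs @ cs')) \<sigma> = run cmp (block cs') (run cmp (block cs) \<sigma>)"
  by (induction cs arbitrary: \<sigma>) auto

definition conj_all :: "bexp list \<Rightarrow> bexp" where
  "conj_all ps = foldr Conj ps (LessEq (Const 0) (Const 0))"

lemma bval_conj_all [simp]: "bval cmp (conj_all ps) \<sigma> \<longleftrightarrow> (\<forall>p\<in>set ps. bval cmp p \<sigma>)"
  by (induction ps) (auto simp: conj_all_def)

definition more_bricks :: bexp where
  "more_bricks = Neg (LessEq (Scalar 0) (Scalar 1))"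

lemma exec_while_bricks:
  assumes lf: "loop_free c"
    and inv: "\<And>i \<sigma>. I i \<sigma> \<Longrightarrow> scalars \<sigma> 0 = int n \<and> scalars \<sigma> 1 = int i"
    and step: "\<And>i \<sigma>. i < n \<Longrightarrow> I i \<sigma> \<Longrightarrow> I (Suc i) (run cmp c \<sigma>)"
    and start: "I i \<sigma>" "i \<le> n"
  shows "\<exists>k \<tau>. exec cmp (While more_bricks c) \<sigma> k \<tau> \<and> k \<le> (n - i) * (5 + max_steps c) + 5 \<and> I n \<tau>"
  using start
proof (induction "n - i" arbitrary: i \<sigma>)
  case 0
  then have "i = n" by simp
  then have "\<not> bval cmp more_bricks \<sigma>" using inv[OF 0(2)] by (simp add: more_bricks_def)
  then show ?case
    using exec.WhileFalse[of cmp more_bricks \<sigma> c] 0 \<open>i = n\<close>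
    by (intro exI[of _ "1 + bcost more_bricks"] exI[of _ \<sigma>]) (auto simp: more_bricks_def)
next
  case (Suc d)
  then have i: "i < n" and d: "d = n - Suc i" by simp_all
  then have b: "bval cmp more_bricks \<sigma>" using inv[OF Suc(3)] by (simp add: more_bricks_def)
  obtain k where k: "exec cmp c \<sigma> k (run cmp c \<sigma>)" "k \<le> max_steps c"
    using exec_loop_free[OF lf] by blast
  obtain k' \<tau> where k': "exec cmp (While more_bricks c) (run cmp c \<sigma>) k' \<tau>"
    "k' \<le> (n - Suc i) * (5 + max_steps c) + 5" "I n \<tau>"
    using Suc.hyps(1)[OF d step[OF i Suc(3)]] i by auto
  have "n - i = Suc (n - Suc i)" using i by simp
  then have "1 + bcost more_bricks + k + k' \<le> (n - i) * (5 + max_steps c) + 5"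
    using k(2) k'(2) by (simp add: more_bricks_def)
  with exec.WhileTrue[OF b k(1) k'(1)] k'(3) show ?case by blast
qed

section \<open>The dynamic program\<close>

text \<open>The iteration for brick \<open>i\<close> keeps \<open>i\<close> in scalar 1. The entry at index \<open>-1\<close>, which lies
  outside of the vector that an array represents, is a flag that travels along when the array is
  copied: it is 1 if and only if the array holds a partial solution.\<close>

definition index :: "nat \<Rightarrow> nat \<Rightarrow> aexp" where
  "index t j = Plus (Times (Scalar 1) (Const (int t))) (Const (int j))"

definition valid :: "array \<Rightarrow> bool" where
  "valid y \<longleftrightarrow> 1 \<le> y (-1)"

definition add_brick :: "nat \<Rightarrow> nat \<Rightarrow> (nat \<Rightarrow> int) \<Rightarrow> array \<Rightarrow> array" where
  "add_brick t i v y =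
     (\<lambda>k. if int (i * t) \<le> k \<and> k < int (i * t + t) then y k + v (nat k - i * t) else y k)"

lemma add_brick_valid [simp]: "valid (add_brick t i v y) \<longleftrightarrow> valid y"
  using of_nat_0_le_iff[of "i * t", where 'a = int]
  by (auto simp: valid_def add_brick_def simp del: of_nat_mult of_nat_0_le_iff)

definition in_box :: "nat \<Rightarrow> nat \<Rightarrow> array \<Rightarrow> array \<Rightarrow> array \<Rightarrow> bool" where
  "in_box t i l u y \<longleftrightarrow>
     (\<forall>j<t. l (int (i * t + j)) \<le> y (int (i * t + j)) \<and> y (int (i * t + j)) \<le> u (int (i * t + j)))"

definition add_brick_com :: "nat \<Rightarrow> (nat \<Rightarrow> int) \<Rightarrow> com" where
  "add_brick_com t v =
     block (map (\<lambda>j. Store 4 (index t j) (Plus (Entry 4 (index t j)) (Const (v j)))) [0..<t])"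

lemma run_add_brick_com:
  assumes "scalars \<sigma> 1 = int i"
  shows "run cmp (add_brick_com t v) \<sigma> =
    State (scalars \<sigma>) ((arrays \<sigma>)(4 := add_brick t i v (arrays \<sigma> 4)))"
proof -
  have "run cmp (block (map (\<lambda>j. Store 4 (index t j) (Plus (Entry 4 (index t j)) (Const (v j)))) [0..<m])) \<sigma> =
    State (scalars \<sigma>) ((arrays \<sigma>)(4 := \<lambda>k. if int (i * t) \<le> k \<and> k < int (i * t + m)
      then arrays \<sigma> 4 k + v (nat k - i * t) else arrays \<sigma> 4 k))" for m
  proof (induction m)
    case 0
    then show ?case by (cases \<sigma>) (auto simp: fun_eq_iff)
  next
    case (Suc m)
    then show ?case using assms by (auto simp: index_def fun_eq_iff nat_add_distrib nat_mult_distrib)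
  qed
  then show ?thesis by (simp add: add_brick_com_def add_brick_def)
qed

definition in_box_test :: "nat \<Rightarrow> bexp" where
  "in_box_test t = conj_all (map (\<lambda>j. Conj (LessEq (Entry 1 (index t j)) (Entry 4 (index t j)))
     (LessEq (Entry 4 (index t j)) (Entry 2 (index t j)))) [0..<t])"

lemma bval_in_box_test:
  assumes "scalars \<sigma> 1 = int i"
  shows "bval cmp (in_box_test t) \<sigma> \<longleftrightarrow> in_box t i (arrays \<sigma> 1) (arrays \<sigma> 2) (arrays \<sigma> 4)"
  using assms by (auto simp: in_box_test_def in_box_def index_def)

definition relax :: "nat \<Rightarrow> nat \<Rightarrow> com" where
  "relax a c = If (Conj (LessEq (Const 1) (Entry a (Const (-1))))
     (Neg (Conj (LessEq (Const 1) (Entry c (Const (-1)))) (Compare c a)))) (Copy c a) Skip"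

definition relaxed :: "(array \<Rightarrow> real) \<Rightarrow> array \<Rightarrow> array \<Rightarrow> array" where
  "relaxed F y w = (if valid y \<and> \<not> (valid w \<and> F w \<le> F y) then y else w)"

abbreviation by_value :: "(array \<Rightarrow> real) \<Rightarrow> array \<Rightarrow> array \<Rightarrow> bool" where
  "by_value F \<equiv> \<lambda>a b. F a \<le> F b"

lemma run_relax:
  "run (by_value F) (relax a c) \<sigma> =
    State (scalars \<sigma>) ((arrays \<sigma>)(c := relaxed F (arrays \<sigma> a) (arrays \<sigma> c)))"
  by (cases \<sigma>) (auto simp: relax_def relaxed_def valid_def)

definition best :: "(array \<Rightarrow> real) \<Rightarrow> array set \<Rightarrow> array \<Rightarrow> bool" where
  "best F S a \<longleftrightarrow> (valid a \<longrightarrow> a \<in> S) \<and> (\<forall>y\<in>S. valid a \<and> F a \<le> F y)"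

lemma best_relaxed:
  assumes "best F S a"
  shows "best F (S \<union> {y'. y' = y \<and> valid y'}) (relaxed F y a)"
  using assms by (auto simp: best_def relaxed_def)

definition extend :: "nat \<Rightarrow> nat \<Rightarrow> (nat \<Rightarrow> int) \<Rightarrow> nat \<Rightarrow> com" where
  "extend t a v c =
     Seq (Copy 4 a) (Seq (add_brick_com t v) (If (in_box_test t) (relax 4 c) Skip))"

lemma run_extend:
  fixes t a :: nat and v :: "nat \<Rightarrow> int"
  assumes "scalars \<sigma> 1 = int i" and "c \<noteq> 4"
  defines "y \<equiv> add_brick t i v (arrays \<sigma> a)"
  shows "run (by_value F) (extend t a v c) \<sigma> = State (scalars \<sigma>) ((arrays \<sigma>)(4 := y,
    c := if in_box t i (arrays \<sigma> 1) (arrays \<sigma> 2) y then relaxed F y (arrays \<sigma> c) else arrays \<sigma> c))"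
  using assms
  by (simp add: extend_def run_add_brick_com[of _ i] bval_in_box_test[of _ i] run_relax fun_upd_idem)

text \<open>A state of the dynamic program is the sum of the bricks chosen so far. Array \<open>cur e z\<close>
  holds the best solution found for state \<open>z\<close>, array \<open>nxt e z\<close> the one for one more brick.\<close>

definition cur :: "('z \<Rightarrow> nat) \<Rightarrow> 'z \<Rightarrow> nat" where "cur e z = 7 + 2 * e z"
definition nxt :: "('z \<Rightarrow> nat) \<Rightarrow> 'z \<Rightarrow> nat" where "nxt e z = 8 + 2 * e z"

lemma cur_nxt_distinct [simp]:
  "cur e z \<noteq> nxt e w" "nxt e w \<noteq> cur e z"
  unfolding cur_def nxt_def by presburger+

lemma cur_nxt_ge [simp]: "k < 7 \<Longrightarrow> cur e z \<noteq> k" "k < 7 \<Longrightarrow> nxt e z \<noteq> k"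
  "k < 7 \<Longrightarrow> k \<noteq> cur e z" "k < 7 \<Longrightarrow> k \<noteq> nxt e z"
  unfolding cur_def nxt_def by auto

lemma cur_nxt_eq_iff [simp]: "cur e z = cur e w \<longleftrightarrow> e z = e w" "nxt e z = nxt e w \<longleftrightarrow> e z = e w"
  by (auto simp: cur_def nxt_def)

definition explore :: "nat \<Rightarrow> ((nat \<Rightarrow> int) \<Rightarrow> nat) \<Rightarrow> ((nat \<Rightarrow> int) \<times> (nat \<Rightarrow> int)) list \<Rightarrow> com" where
  "explore t e es = block (map (\<lambda>(z, w). extend t (cur e z) (\<lambda>j. w j - z j) (nxt e w)) es)"

definition advance :: "('z \<Rightarrow> nat) \<Rightarrow> 'z list \<Rightarrow> com" where
  "advance e zs = block (map (\<lambda>z. Seq (Copy (cur e z) (nxt e z)) (Copy (nxt e z) 5)) zs)"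

definition stage ::
  "nat \<Rightarrow> ((nat \<Rightarrow> int) \<Rightarrow> nat) \<Rightarrow> ((nat \<Rightarrow> int) \<times> (nat \<Rightarrow> int)) list \<Rightarrow> (nat \<Rightarrow> int) list \<Rightarrow> com" where
  "stage t e es zs =
     Seq (explore t e es) (Seq (advance e zs) (Assign 1 (Plus (Scalar 1) (Const 1))))"

definition select :: "('z \<Rightarrow> nat) \<Rightarrow> 'z list \<Rightarrow> com" where
  "select e ts = block (map (\<lambda>z. relax (cur e z) 6) ts)"

definition start :: "((nat \<Rightarrow> int) \<Rightarrow> nat) \<Rightarrow> com" where
  "start e = block [Copy (cur e (\<lambda>_. 0)) 3, Store (cur e (\<lambda>_. 0)) (Const (-1)) (Const 1),
     Copy 6 (cur e (\<lambda>_. 0))]"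

definition subtract :: "nat \<Rightarrow> com" where
  "subtract t = Seq (block (map (\<lambda>j. Store 0 (index t j)
     (Minus (Entry 6 (index t j)) (Entry 3 (index t j)))) [0..<t])) (Assign 1 (Plus (Scalar 1) (Const 1)))"

definition answer_com :: "nat \<Rightarrow> com" where
  "answer_com t = If (Compare 3 6) (Assign 0 (Const 0))
     (Seq (Assign 1 (Const 0)) (While more_bricks (subtract t)))"

definition program :: "nat \<Rightarrow> ((nat \<Rightarrow> int) \<Rightarrow> nat) \<Rightarrow> ((nat \<Rightarrow> int) \<times> (nat \<Rightarrow> int)) list \<Rightarrow>
    (nat \<Rightarrow> int) list \<Rightarrow> (nat \<Rightarrow> int) list \<Rightarrow> com" where
  "program t e es zs ts =
     Seq (start e) (Seq (While more_bricks (stage t e es zs)) (Seq (select e ts) (answer_com t)))"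

lemma loop_free_stage: "loop_free (stage t e es zs)"
  by (auto simp: stage_def explore_def advance_def extend_def relax_def add_brick_com_def)

lemma loop_free_select: "loop_free (select e ts)"
  by (auto simp: select_def relax_def)

lemma loop_free_start: "loop_free (start e)"
  by (auto simp: start_def)

lemma loop_free_subtract: "loop_free (subtract t)"
  by (auto simp: subtract_def)

definition candidates :: "nat \<Rightarrow> nat \<Rightarrow> array \<Rightarrow> array \<Rightarrow> ((nat \<Rightarrow> int) \<Rightarrow> array) \<Rightarrow>
    ((nat \<Rightarrow> int) \<times> (nat \<Rightarrow> int)) list \<Rightarrow> (nat \<Rightarrow> int) \<Rightarrow> array set" where
  "candidates t i l u c es w = {y. valid y \<and> in_box t i l u y \<and>
     (\<exists>z. (z, w) \<in> set es \<and> y = add_brick t i (\<lambda>j. w j - z j) (c z))}"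

lemma candidates_Nil [simp]: "candidates t i l u c [] w = {}"
  by (simp add: candidates_def)

lemma candidates_snoc:
  "candidates t i l u c (es @ [(z, w')]) w = candidates t i l u c es w \<union>
     (if w = w' \<and> in_box t i l u (add_brick t i (\<lambda>j. w j - z j) (c z))
      then {y. y = add_brick t i (\<lambda>j. w j - z j) (c z) \<and> valid y} else {})"
  by (auto simp: candidates_def)

lemma run_explore_snoc:
  "run cmp (explore t e (es @ [(z, w)])) \<sigma> =
    run cmp (extend t (cur e z) (\<lambda>j. w j - z j) (nxt e w)) (run cmp (explore t e es) \<sigma>)"
  by (simp add: explore_def)

lemma run_explore:
  fixes F :: "array \<Rightarrow> real" and t :: nat
  assumes "inj_on e Z" and "set es \<subseteq> Z \<times> Z" and i: "scalars \<sigma> 1 = int i"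
    and blank: "\<And>w. w \<in> Z \<Longrightarrow> \<not> valid (arrays \<sigma> (nxt e w))"
  defines "\<tau> \<equiv> run (by_value F) (explore t e es) \<sigma>"
  shows "scalars \<tau> = scalars \<sigma> \<and>
    (\<forall>a. a \<noteq> 4 \<longrightarrow> (\<forall>w. a \<noteq> nxt e w) \<longrightarrow> arrays \<tau> a = arrays \<sigma> a) \<and>
    (\<forall>w\<in>Z. best F (candidates t i (arrays \<sigma> 1) (arrays \<sigma> 2) (\<lambda>z. arrays \<sigma> (cur e z)) es w)
      (arrays \<tau> (nxt e w)))"
  using assms(2) unfolding \<tau>_def
proof (induction es rule: rev_induct)
  case Nil
  then show ?case using blank by (auto simp: explore_def best_def)
next
  case (snoc p es)
  obtain z w' where p: "p = (z, w')" by force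
  have zw: "z \<in> Z" "w' \<in> Z" using snoc.prems p by auto
  let ?\<rho> = "run (by_value F) (explore t e es) \<sigma>"
  define y where "y = add_brick t i (\<lambda>j. w' j - z j) (arrays \<sigma> (cur e z))"
  have IH: "scalars ?\<rho> = scalars \<sigma>"
    "\<And>a. a \<noteq> 4 \<Longrightarrow> (\<And>w. a \<noteq> nxt e w) \<Longrightarrow> arrays ?\<rho> a = arrays \<sigma> a"
    "\<And>w. w \<in> Z \<Longrightarrow> best F (candidates t i (arrays \<sigma> 1) (arrays \<sigma> 2) (\<lambda>z. arrays \<sigma> (cur e z)) es w)
      (arrays ?\<rho> (nxt e w))"
    using snoc by auto
  have same: "arrays ?\<rho> 1 = arrays \<sigma> 1" "arrays ?\<rho> 2 = arrays \<sigma> 2"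
    "arrays ?\<rho> (cur e z) = arrays \<sigma> (cur e z)"
    by (intro IH(2); simp)+
  have eq: "run (by_value F) (explore t e (es @ [p])) \<sigma> =
      State (scalars \<sigma>) ((arrays ?\<rho>)(4 := y, nxt e w' :=
        if in_box t i (arrays \<sigma> 1) (arrays \<sigma> 2) y then relaxed F y (arrays ?\<rho> (nxt e w'))
        else arrays ?\<rho> (nxt e w')))"
    using run_extend[of ?\<rho> i "nxt e w'" F t "cur e z" "\<lambda>j. w' j - z j"] i
    unfolding p run_explore_snoc same IH(1) y_def by simp
  have "best F (candidates t i (arrays \<sigma> 1) (arrays \<sigma> 2) (\<lambda>z. arrays \<sigma> (cur e z)) (es @ [p]) w)
      (arrays (run (by_value F) (explore t e (es @ [p])) \<sigma>) (nxt e w))" if "w \<in> Z" for w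
  proof (cases "w = w'")
    case True
    then show ?thesis
      unfolding p eq[unfolded p] candidates_snoc using IH(3)[OF that] best_relaxed[OF IH(3)[OF that], of y]
      by (auto simp flip: y_def)
  next
    case False
    then have "e w \<noteq> e w'" using assms(1) that zw by (auto dest: inj_onD)
    then show ?thesis unfolding p eq[unfolded p] candidates_snoc using IH(3)[OF that] False by simp
  qed
  then show ?case using IH(2) unfolding eq by auto
qed

lemma run_advance:
  fixes cmp :: "array \<Rightarrow> array \<Rightarrow> bool" and \<sigma> :: state
  assumes "inj_on e Z" and "set zs \<subseteq> Z" and "distinct zs"
  defines "\<tau> \<equiv> run cmp (advance e zs) \<sigma>"
  shows "scalars \<tau> = scalars \<sigma> \<and>
    (\<forall>a. (\<forall>z\<in>set zs. a \<noteq> cur e z \<and> a \<noteq> nxt e z) \<longrightarrow> arrays \<tau> a = arrays \<sigma> a) \<and>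
    (\<forall>z\<in>set zs. arrays \<tau> (cur e z) = arrays \<sigma> (nxt e z) \<and> arrays \<tau> (nxt e z) = arrays \<sigma> 5)"
  using assms(2,3) unfolding \<tau>_def
proof (induction zs rule: rev_induct)
  case Nil
  then show ?case by (simp add: advance_def)
next
  case (snoc z zs)
  let ?\<rho> = "run cmp (advance e zs) \<sigma>"
  have IH: "scalars ?\<rho> = scalars \<sigma>"
    "\<And>a. (\<And>z. z \<in> set zs \<Longrightarrow> a \<noteq> cur e z \<and> a \<noteq> nxt e z) \<Longrightarrow> arrays ?\<rho> a = arrays \<sigma> a"
    "\<And>z. z \<in> set zs \<Longrightarrow> arrays ?\<rho> (cur e z) = arrays \<sigma> (nxt e z) \<and> arrays ?\<rho> (nxt e z) = arrays \<sigma> 5"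
    using snoc by auto
  have ez: "e z \<noteq> e w" "e w \<noteq> e z" if "w \<in> set zs" for w
    using assms(1) snoc.prems that by (auto dest: inj_onD)
  have same: "arrays ?\<rho> 5 = arrays \<sigma> 5" "arrays ?\<rho> (nxt e z) = arrays \<sigma> (nxt e z)"
    by (intro IH(2); use ez in simp)+
  have eq: "run cmp (advance e (zs @ [z])) \<sigma> = State (scalars \<sigma>)
      ((arrays ?\<rho>)(cur e z := arrays \<sigma> (nxt e z), nxt e z := arrays \<sigma> 5))"
    by (simp add: advance_def[of e "zs @ [z]"] advance_def[of e zs, symmetric] same IH(1))
  show ?case using IH(2,3) ez unfolding eq by auto
qed

lemma run_select:
  fixes e :: "'z \<Rightarrow> nat" and ts :: "'z list"
  assumes "best F S (arrays \<sigma> 6)"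
  defines "\<tau> \<equiv> run (by_value F) (select e ts) \<sigma>"
  shows "scalars \<tau> = scalars \<sigma> \<and> (\<forall>a. a \<noteq> 6 \<longrightarrow> arrays \<tau> a = arrays \<sigma> a) \<and>
    best F (S \<union> {y. valid y \<and> (\<exists>z\<in>set ts. y = arrays \<sigma> (cur e z))}) (arrays \<tau> 6)"
  unfolding \<tau>_def
proof (induction ts rule: rev_induct)
  case Nil
  then show ?case using assms by (simp add: select_def)
next
  case (snoc z ts)
  let ?\<rho> = "run (by_value F) (select e ts) \<sigma>"
  let ?S = "\<lambda>ts. S \<union> {y. valid y \<and> (\<exists>z\<in>set ts. y = arrays \<sigma> (cur e z))}"
  have eq: "run (by_value F) (select e (ts @ [z])) \<sigma> = State (scalars \<sigma>)
      ((arrays ?\<rho>)(6 := relaxed F (arrays \<sigma> (cur e z)) (arrays ?\<rho> 6)))"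
    using snoc by (simp add: select_def[of e "ts @ [z]"] select_def[of e ts, symmetric] run_relax)
  have S: "?S (ts @ [z]) = ?S ts \<union> {y. y = arrays \<sigma> (cur e z) \<and> valid y}" by auto
  have "best F (?S (ts @ [z])) (relaxed F (arrays \<sigma> (cur e z)) (arrays ?\<rho> 6))"
    unfolding S using snoc by (intro best_relaxed) blast
  then show ?case using snoc unfolding eq by auto
qed

lemma run_subtract:
  assumes "scalars \<sigma> 1 = int i"
  shows "run cmp (subtract t) \<sigma> = State ((scalars \<sigma>)(1 := int (Suc i)))
    ((arrays \<sigma>)(0 := \<lambda>k. if int (i * t) \<le> k \<and> k < int (i * t + t)
      then arrays \<sigma> 6 k - arrays \<sigma> 3 k else arrays \<sigma> 0 k))"
proof -
  have "run cmp (block (map (\<lambda>j. Store 0 (index t j)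
      (Minus (Entry 6 (index t j)) (Entry 3 (index t j)))) [0..<m])) \<sigma> =
    State (scalars \<sigma>) ((arrays \<sigma>)(0 := \<lambda>k. if int (i * t) \<le> k \<and> k < int (i * t + m)
      then arrays \<sigma> 6 k - arrays \<sigma> 3 k else arrays \<sigma> 0 k))" for m
  proof (induction m)
    case 0
    then show ?case by (cases \<sigma>) (auto simp: fun_eq_iff)
  next
    case (Suc m)
    then show ?case using assms by (auto simp: index_def fun_eq_iff)
  qed
  then show ?thesis using assms by (simp add: subtract_def add.commute)
qed

locale brick_program =
  fixes n t :: nat and Z :: "(nat \<Rightarrow> int) set" and e :: "(nat \<Rightarrow> int) \<Rightarrow> nat"
    and es :: "((nat \<Rightarrow> int) \<times> (nat \<Rightarrow> int)) list" and zs ts :: "(nat \<Rightarrow> int) list"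
    and F :: "array \<Rightarrow> real" and \<psi> :: "nat \<Rightarrow> int \<Rightarrow> real" and l u x :: array
  assumes inj: "inj_on e Z" and es: "set es \<subseteq> Z \<times> Z" and zs: "set zs = Z" "distinct zs"
    and ts: "set ts \<subseteq> Z" and zero: "(\<lambda>_. 0) \<in> Z"
    and F: "F y = (\<Sum>k<n * t. \<psi> k (y (int k)))"
begin

definition x\<^sub>0 :: array where "x\<^sub>0 = x(-1 := 1)"

lemma x\<^sub>0_int: "x\<^sub>0 (int k) = x (int k)"
  by (simp add: x\<^sub>0_def)

primrec reach :: "nat \<Rightarrow> (nat \<Rightarrow> int) \<Rightarrow> array set" where
  "reach 0 z = (if z = (\<lambda>_. 0) then {x\<^sub>0} else {})"
| "reach (Suc i) w = {y'. \<exists>z y. (z, w) \<in> set es \<and> y \<in> reach i z \<and>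
     y' = add_brick t i (\<lambda>j. w j - z j) y \<and> in_box t i l u y'}"

lemma reach_tail: "y \<in> reach i z \<Longrightarrow> k < 0 \<or> int (i * t) \<le> k \<Longrightarrow> y k = x\<^sub>0 k"
proof (induction i arbitrary: y z)
  case (Suc i)
  then obtain z' y' where y': "y' \<in> reach i z'" "y = add_brick t i (\<lambda>j. z j - z' j) y'" by auto
  have "y' k = x\<^sub>0 k" using Suc.IH[OF y'(1)] Suc.prems(2) by auto
  then show ?case
    using y'(2) Suc.prems(2) of_nat_0_le_iff[of "i * t", where 'a = int]
    by (auto simp: add_brick_def simp del: of_nat_mult of_nat_0_le_iff)
qed (auto split: if_splits)

lemma F_add_brick_mono:
  assumes "F y \<le> F y'" and "\<And>k. int (i * t) \<le> k \<Longrightarrow> y k = y' k"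
  shows "F (add_brick t i v y) \<le> F (add_brick t i v y')"
proof -
  have "F (add_brick t i v y) - F y = F (add_brick t i v y') - F y'"
    unfolding F sum_subtractf[symmetric] using assms(2) by (intro sum.cong) (auto simp: add_brick_def)
  with assms(1) show ?thesis by linarith
qed

lemma best_reach_Suc:
  assumes c: "\<And>z. z \<in> Z \<Longrightarrow> best F (reach i z) (c z)"
    and a: "best F (candidates t i l u c es w) a"
  shows "best F (reach (Suc i) w) a"
  unfolding best_def
proof (intro conjI impI ballI)
  assume "valid a"
  with a have "a \<in> candidates t i l u c es w" by (simp add: best_def)
  then obtain z where z: "(z, w) \<in> set es" "a = add_brick t i (\<lambda>j. w j - z j) (c z)"
    "in_box t i l u a" "valid a"
    by (auto simp: candidates_def)
  then have "c z \<in> reach i z" using c[of z] es by (auto simp: best_def)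
  with z show "a \<in> reach (Suc i) w" by auto
next
  fix y assume "y \<in> reach (Suc i) w"
  then obtain z y' where z: "(z, w) \<in> set es" "y' \<in> reach i z"
    "y = add_brick t i (\<lambda>j. w j - z j) y'" "in_box t i l u y"
    by auto
  have cz: "valid (c z)" "F (c z) \<le> F y'" "c z \<in> reach i z"
    using c[of z] z es by (auto simp: best_def)
  have tail: "c z k = y' k" if "int (i * t) \<le> k" for k
    using reach_tail[OF cz(3)] reach_tail[OF z(2)] that by simp
  let ?y = "add_brick t i (\<lambda>j. w j - z j) (c z)"
  have "in_box t i l u ?y" using z(3,4) tail by (simp add: in_box_def add_brick_def)
  then have "?y \<in> candidates t i l u c es w" using z(1) cz(1) by (auto simp: candidates_def)
  then have "valid a \<and> F a \<le> F ?y" using a by (auto simp: best_def)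
  moreover have "F ?y \<le> F y" unfolding z(3) by (rule F_add_brick_mono[OF cz(2) tail])
  ultimately show "valid a" "F a \<le> F y" by auto
qed

definition stage_inv :: "nat \<Rightarrow> state \<Rightarrow> bool" where
  "stage_inv i \<sigma> \<longleftrightarrow> scalars \<sigma> 0 = int n \<and> scalars \<sigma> 1 = int i \<and>
     arrays \<sigma> 1 = l \<and> arrays \<sigma> 2 = u \<and> arrays \<sigma> 3 = x \<and> arrays \<sigma> 5 = (\<lambda>_. 0) \<and> arrays \<sigma> 6 = x\<^sub>0 \<and>
     (\<forall>z\<in>Z. arrays \<sigma> (nxt e z) = (\<lambda>_. 0) \<and> best F (reach i z) (arrays \<sigma> (cur e z)))"

lemma stage_inv_scalars: "stage_inv i \<sigma> \<Longrightarrow> scalars \<sigma> 0 = int n \<and> scalars \<sigma> 1 = int i"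
  by (simp add: stage_inv_def)

lemma stage_inv_Suc:
  assumes "stage_inv i \<sigma>"
  shows "stage_inv (Suc i) (run (by_value F) (stage t e es zs) \<sigma>)"
proof -
  have inv: "scalars \<sigma> 0 = int n" "scalars \<sigma> 1 = int i" "arrays \<sigma> 1 = l" "arrays \<sigma> 2 = u"
    "arrays \<sigma> 3 = x" "arrays \<sigma> 5 = (\<lambda>_. 0)" "arrays \<sigma> 6 = x\<^sub>0"
    "\<And>z. z \<in> Z \<Longrightarrow> arrays \<sigma> (nxt e z) = (\<lambda>_. 0)"
    "\<And>z. z \<in> Z \<Longrightarrow> best F (reach i z) (arrays \<sigma> (cur e z))"
    using assms by (auto simp: stage_inv_def)
  define \<rho> where "\<rho> = run (by_value F) (explore t e es) \<sigma>"
  define \<tau> where "\<tau> = run (by_value F) (advance e zs) \<rho>"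
  have \<rho>: "scalars \<rho> = scalars \<sigma>"
    "\<And>a. a \<noteq> 4 \<Longrightarrow> (\<And>w. a \<noteq> nxt e w) \<Longrightarrow> arrays \<rho> a = arrays \<sigma> a"
    "\<And>w. w \<in> Z \<Longrightarrow> best F (candidates t i l u (\<lambda>z. arrays \<sigma> (cur e z)) es w) (arrays \<rho> (nxt e w))"
    using run_explore[OF inj es inv(2), of F t] inv(3,4,8) by (auto simp: \<rho>_def valid_def)
  have \<tau>: "scalars \<tau> = scalars \<rho>"
    "\<And>a. (\<And>z. z \<in> Z \<Longrightarrow> a \<noteq> cur e z \<and> a \<noteq> nxt e z) \<Longrightarrow> arrays \<tau> a = arrays \<rho> a"
    "\<And>z. z \<in> Z \<Longrightarrow> arrays \<tau> (cur e z) = arrays \<rho> (nxt e z) \<and> arrays \<tau> (nxt e z) = arrays \<rho> 5"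
    using run_advance[OF inj, of zs "by_value F" \<rho>] zs by (auto simp: \<tau>_def)
  have same: "arrays \<tau> k = arrays \<sigma> k" if "k < 7" "k \<noteq> 4" for k
    using \<tau>(2)[of k] \<rho>(2)[of k] that by simp
  have "arrays \<tau> (nxt e z) = (\<lambda>_. 0) \<and> best F (reach (Suc i) z) (arrays \<tau> (cur e z))" if "z \<in> Z" for z
    using \<tau>(3)[OF that] \<rho>(2)[of 5] inv(6) best_reach_Suc[OF inv(9) \<rho>(3)[OF that]] by simp
  then show ?thesis
    using inv \<tau>(1) \<rho>(1) same by (simp add: stage_inv_def stage_def flip: \<rho>_def \<tau>_def del: reach.simps)
qed

definition final_inv :: "array \<Rightarrow> nat \<Rightarrow> state \<Rightarrow> bool" where
  "final_inv y i \<sigma> \<longleftrightarrow> scalars \<sigma> 0 = int n \<and> scalars \<sigma> 1 = int i \<and> arrays \<sigma> 3 = x \<and>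
     arrays \<sigma> 6 = y \<and> (\<forall>k. 0 \<le> k \<and> k < int (i * t) \<longrightarrow> arrays \<sigma> 0 k = y k - x k)"

lemma final_inv_scalars: "final_inv y i \<sigma> \<Longrightarrow> scalars \<sigma> 0 = int n \<and> scalars \<sigma> 1 = int i"
  by (simp add: final_inv_def)

lemma final_inv_Suc:
  assumes "final_inv y i \<sigma>"
  shows "final_inv y (Suc i) (run cmp (subtract t) \<sigma>)"
  using assms run_subtract[of \<sigma> i cmp t] by (auto simp: final_inv_def algebra_simps)

lemma program_correct:
  assumes n: "n \<ge> 1" and \<sigma>: "scalars \<sigma> 0 = int n" "scalars \<sigma> 1 = 0"
    "arrays \<sigma> 1 = l" "arrays \<sigma> 2 = u" "arrays \<sigma> 3 = x" "\<And>a. a > 3 \<Longrightarrow> arrays \<sigma> a = (\<lambda>_. 0)"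
  shows "\<exists>k \<tau> y. exec (by_value F) (program t e es zs ts) \<sigma> k \<tau> \<and>
    k \<le> (max_steps (start e) + max_steps (stage t e es zs) + max_steps (select e ts) +
      max_steps (subtract t) + 100) * n \<and>
    (y = x\<^sub>0 \<or> (\<exists>z\<in>set ts. y \<in> reach n z)) \<and> (\<forall>z\<in>set ts. \<forall>y'\<in>reach n z. F y \<le> F y') \<and>
    (if F x \<le> F y then scalars \<tau> 0 = 0
     else scalars \<tau> 0 \<noteq> 0 \<and> (\<forall>k. 0 \<le> k \<and> k < int (n * t) \<longrightarrow> arrays \<tau> 0 k = y k - x k))"
proof -
  obtain k1 where k1: "exec (by_value F) (start e) \<sigma> k1 (run (by_value F) (start e) \<sigma>)"
    "k1 \<le> max_steps (start e)"
    using exec_loop_free[OF loop_free_start] by blast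
  define \<sigma>1 where "\<sigma>1 = run (by_value F) (start e) \<sigma>"
  have \<sigma>1: "\<sigma>1 = State (scalars \<sigma>) ((arrays \<sigma>)(cur e (\<lambda>_. 0) := x\<^sub>0, 6 := x\<^sub>0))"
    using \<sigma> by (simp add: \<sigma>1_def start_def x\<^sub>0_def)
  have gt3: "cur e z > 3" "nxt e z > 3" for z by (auto simp: cur_def nxt_def)
  have "stage_inv 0 \<sigma>1"
    unfolding stage_inv_def
  proof (intro conjI ballI)
    fix z assume z: "z \<in> Z"
    show "arrays \<sigma>1 (nxt e z) = (\<lambda>_. 0)" using \<sigma>(6) gt3 by (simp add: \<sigma>1)
    show "best F (reach 0 z) (arrays \<sigma>1 (cur e z))"
    proof (cases "z = (\<lambda>_. 0)")
      case False
      then have "e z \<noteq> e (\<lambda>_. 0)" using inj z zero by (auto dest: inj_onD)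
      then show ?thesis using False \<sigma>(6) gt3 by (simp add: \<sigma>1 best_def valid_def)
    qed (simp add: \<sigma>1 best_def valid_def x\<^sub>0_def)
  qed (use \<sigma> in \<open>simp_all add: \<sigma>1\<close>)
  from exec_while_bricks[where I = stage_inv, OF loop_free_stage stage_inv_scalars stage_inv_Suc this le0]
  obtain k2 \<sigma>2 where k2: "exec (by_value F) (While more_bricks (stage t e es zs)) \<sigma>1 k2 \<sigma>2"
    "k2 \<le> (n - 0) * (5 + max_steps (stage t e es zs)) + 5" "stage_inv n \<sigma>2"
    by blast
  obtain k3 where k3: "exec (by_value F) (select e ts) \<sigma>2 k3 (run (by_value F) (select e ts) \<sigma>2)"
    "k3 \<le> max_steps (select e ts)"
    using exec_loop_free[OF loop_free_select] by blast
  define \<sigma>3 where "\<sigma>3 = run (by_value F) (select e ts) \<sigma>2"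
  define y where "y = arrays \<sigma>3 6"
  let ?S = "{x\<^sub>0} \<union> {y. valid y \<and> (\<exists>z\<in>set ts. y = arrays \<sigma>2 (cur e z))}"
  have \<sigma>3: "scalars \<sigma>3 = scalars \<sigma>2" "\<And>a. a \<noteq> 6 \<Longrightarrow> arrays \<sigma>3 a = arrays \<sigma>2 a" "best F ?S y"
    using run_select[of F "{x\<^sub>0}" \<sigma>2 e ts] k2(3)
    by (auto simp: y_def \<sigma>3_def stage_inv_def best_def valid_def x\<^sub>0_def)
  have reach_best: "best F (reach n z) (arrays \<sigma>2 (cur e z))" if "z \<in> set ts" for z
    using k2(3) ts that by (auto simp: stage_inv_def)
  have "y \<in> ?S" and y_le: "\<And>y'. y' \<in> ?S \<Longrightarrow> F y \<le> F y'" using \<sigma>3(3) by (auto simp: best_def)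
  then have y_reach: "y = x\<^sub>0 \<or> (\<exists>z\<in>set ts. y \<in> reach n z)"
    using reach_best by (auto simp: best_def)
  have y_best: "F y \<le> F y'" if "z \<in> set ts" "y' \<in> reach n z" for z y'
  proof -
    have "valid (arrays \<sigma>2 (cur e z))" "F (arrays \<sigma>2 (cur e z)) \<le> F y'"
      using reach_best[OF that(1)] that(2) by (auto simp: best_def)
    moreover then have "F y \<le> F (arrays \<sigma>2 (cur e z))" using that(1) by (intro y_le) auto
    ultimately show ?thesis by simp
  qed
  have arr3: "arrays \<sigma>3 3 = x" "scalars \<sigma>3 0 = int n" using \<sigma>3 k2(3) by (auto simp: stage_inv_def)
  have "\<exists>k4 \<tau>. exec (by_value F) (answer_com t) \<sigma>3 k4 \<tau> \<and> k4 \<le> n * (5 + max_steps (subtract t)) + 20 \<and>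
      (if F x \<le> F y then scalars \<tau> 0 = 0
       else scalars \<tau> 0 \<noteq> 0 \<and> (\<forall>k. 0 \<le> k \<and> k < int (n * t) \<longrightarrow> arrays \<tau> 0 k = y k - x k))"
  proof (cases "F x \<le> F y")
    case True
    then have "bval (by_value F) (Compare 3 6) \<sigma>3" using arr3 by (simp add: y_def)
    from exec.IfTrue[OF this exec.Assign] True show ?thesis
      unfolding answer_com_def by fastforce
  next
    case False
    then have neg: "\<not> bval (by_value F) (Compare 3 6) \<sigma>3" using arr3 by (simp add: y_def)
    define \<sigma>4 where "\<sigma>4 = State ((scalars \<sigma>3)(1 := 0)) (arrays \<sigma>3)"
    have "final_inv y 0 \<sigma>4" using arr3 by (simp add: final_inv_def \<sigma>4_def y_def)
    from exec_while_bricks[where I = "final_inv y" and cmp = "by_value F", OF loop_free_subtract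
        final_inv_scalars[of y] final_inv_Suc this le0]
    obtain k \<tau> where k: "exec (by_value F) (While more_bricks (subtract t)) \<sigma>4 k \<tau>"
      "k \<le> (n - 0) * (5 + max_steps (subtract t)) + 5" "final_inv y n \<tau>"
      by blast
    have "exec (by_value F) (Assign 1 (Const 0)) \<sigma>3 2 \<sigma>4"
      using exec.Assign[of "by_value F" 1 "Const 0" \<sigma>3] by (simp add: \<sigma>4_def numeral_2_eq_2)
    from exec.IfFalse[OF neg exec.Seq[OF this k(1)]] k(2,3) False n show ?thesis
      unfolding answer_com_def by (intro exI[of _ "1 + bcost (Compare 3 6) + (1 + 2 + k)"] exI[of _ \<tau>])
        (auto simp: final_inv_def)
  qed
  then obtain k4 \<tau> where k4: "exec (by_value F) (answer_com t) \<sigma>3 k4 \<tau>"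
    "k4 \<le> n * (5 + max_steps (subtract t)) + 20"
    "if F x \<le> F y then scalars \<tau> 0 = 0
     else scalars \<tau> 0 \<noteq> 0 \<and> (\<forall>k. 0 \<le> k \<and> k < int (n * t) \<longrightarrow> arrays \<tau> 0 k = y k - x k)"
    by blast
  have "exec (by_value F) (program t e es zs ts) \<sigma> (1 + k1 + (1 + k2 + (1 + k3 + k4))) \<tau>"
    unfolding program_def
    using k1(1) k2(1) k3(1) k4(1) by (intro exec.Seq) (simp_all add: \<sigma>1_def \<sigma>3_def)
  moreover have "1 + k1 + (1 + k2 + (1 + k3 + k4)) \<le>
      (max_steps (start e) + max_steps (stage t e es zs) + max_steps (select e ts) +
      max_steps (subtract t) + 100) * n"
  proof -
    have le: "a \<le> a * n" for a using n by (cases n) auto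
    have "k2 \<le> max_steps (stage t e es zs) * n + 5 * n + 5"
      "k4 \<le> max_steps (subtract t) * n + 5 * n + 20"
      using k2(2) k4(2) by (simp_all add: algebra_simps)
    then show ?thesis
      using k1(2) k3(2) le[of "max_steps (start e)"] le[of "max_steps (select e ts)"] n
      unfolding add_mult_distrib by linarith
  qed
  ultimately show ?thesis using y_reach y_best k4(3) by blast
qed

end

context brick_program
begin

lemma reach_sound:
  assumes "y \<in> reach i z"
    and kernel: "\<And>z w. (z, w) \<in> set es \<Longrightarrow> annihilates A I t (\<lambda>j. w j - z j)"
  shows "(\<forall>p<i. annihilates A I t (\<lambda>j. y (int (p * t + j)) - x (int (p * t + j))) \<and> in_box t p l u y) \<and>
    (\<forall>j<t. z j = (\<Sum>p<i. y (int (p * t + j)) - x (int (p * t + j))))"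
  using assms(1)
proof (induction i arbitrary: y z)
  case 0
  then show ?case by (simp split: if_splits)
next
  case (Suc i)
  then obtain z' y' where y': "(z', z) \<in> set es" "y' \<in> reach i z'" "in_box t i l u y"
    and y: "y = add_brick t i (\<lambda>j. z j - z' j) y'" by auto
  note IH = Suc.IH[OF y'(2)]
  have old: "y (int (p * t + j)) = y' (int (p * t + j))" if "p < i" "j < t" for p j
    using block_index_less[OF that] unfolding y add_brick_def by (simp flip: of_nat_mult of_nat_add)
  have new: "y (int (i * t + j)) - x (int (i * t + j)) = z j - z' j" if "j < t" for j
  proof -
    have "y' (int (i * t + j)) = x (int (i * t + j))"
      using reach_tail[OF y'(2), of "int (i * t + j)"] unfolding x\<^sub>0_int by simp
    moreover have "y (int (i * t + j)) = y' (int (i * t + j)) + (z j - z' j)"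
      using that unfolding y add_brick_def by (auto simp: nat_add_distrib nat_mult_distrib)
    ultimately show ?thesis by simp
  qed
  have "annihilates A I t (\<lambda>j. y (int (p * t + j)) - x (int (p * t + j))) \<and> in_box t p l u y"
    if "p < Suc i" for p
  proof (cases "p = i")
    case True
    then show ?thesis
      using y'(3) kernel[OF y'(1)] new
        annihilates_cong[of t "\<lambda>j. y (int (i * t + j)) - x (int (i * t + j))" "\<lambda>j. z j - z' j" A I]
      by simp
  next
    case False
    with that have "p < i" by simp
    then show ?thesis using IH old[OF \<open>p < i\<close>] by (auto simp: annihilates_def in_box_def)
  qed
  moreover have "z j = (\<Sum>p<Suc i. y (int (p * t + j)) - x (int (p * t + j)))" if "j < t" for j
    using IH old new[OF that] that by simp
  ultimately show ?case by blast
qed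

lemma reach_complete:
  fixes g :: "nat \<Rightarrow> int"
  defines "W m j \<equiv> if j < t then \<Sum>p<m. g (p * t + j) else 0"
    and "Y m k \<equiv> if 0 \<le> k \<and> k < int (m * t) then x k + g (nat k) else x\<^sub>0 k"
  assumes "m \<le> n"
    and edges: "\<And>m. m < n \<Longrightarrow> (W m, W (Suc m)) \<in> set es"
    and bounds: "\<And>m. m < n \<Longrightarrow> in_box t m l u (\<lambda>k. x k + g (nat k))"
  shows "Y m \<in> reach m (W m)"
  using \<open>m \<le> n\<close>
proof (induction m)
  case 0
  have "Y 0 = x\<^sub>0" by (auto simp: Y_def fun_eq_iff)
  moreover have "W 0 = (\<lambda>_. 0)" by (simp add: W_def fun_eq_iff)
  ultimately show ?case by simp
next
  case (Suc m)
  then have m: "m < n" "Y m \<in> reach m (W m)" by auto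
  have "Y (Suc m) = add_brick t m (\<lambda>j. W (Suc m) j - W m j) (Y m)"
  proof
    fix k
    show "Y (Suc m) k = add_brick t m (\<lambda>j. W (Suc m) j - W m j) (Y m) k"
    proof (cases "int (m * t) \<le> k \<and> k < int (m * t + t)")
      case True
      then obtain j where j: "k = int (m * t + j)" "j < t"
        by (metis add_less_cancel_left le_Suc_ex of_nat_le_iff of_nat_less_iff zero_le_imp_eq_int
            order_trans of_nat_0_le_iff)
      then show ?thesis
        unfolding j(1) Y_def W_def add_brick_def x\<^sub>0_int nat_int by simp
    next
      case False
      then have "k < int (m * t) \<longleftrightarrow> k < int (Suc m * t)" by (auto simp: algebra_simps)
      with False show ?thesis by (auto simp: Y_def add_brick_def)
    qed
  qed
  moreover have "in_box t m l u (Y (Suc m))"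
    using bounds[OF m(1)] block_index_less[of m "Suc m" _ t]
    by (simp add: in_box_def Y_def flip: of_nat_mult of_nat_add)
  ultimately show ?case using m(2) edges[OF m(1)] by auto
qed

end

theorem theorem4p1:
  fixes r s t :: nat and A :: "int mat"
  assumes "A \<in> carrier_mat (r + s) t"
  shows "\<exists>(P :: com) (C :: nat).
    \<forall>(n :: nat) (b :: int vec) (l :: int vec) (u :: int vec) (f :: real vec \<Rightarrow> real) (x :: int vec).
      n \<ge> 1 \<longrightarrow>
      b \<in> carrier_vec (r + n * s) \<longrightarrow>
      l \<in> carrier_vec (n * t) \<longrightarrow>
      u \<in> carrier_vec (n * t) \<longrightarrow>
      separable_convex n t f \<longrightarrow>
      feasible (nfold r s t A n) b l u x \<longrightarrow>
      (\<exists>k \<sigma>.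
        exec (comparison (n * t) f) P (input_state n b l u x) k \<sigma> \<and>
        k \<le> C * n \<and>
        (case answer_of (n * t) \<sigma> of
           Is_Optimal \<Rightarrow> optimal (nfold r s t A n) b l u f x
         | Step g \<Rightarrow>
             augmenting_step (nfold r s t A n) b l u f x g \<and>
             (\<forall>g' \<in> Graver (nfold r s t A n).
                feasible_step (nfold r s t A n) b l u x g' \<longrightarrow>
                at_int f (x + g) \<le> at_int f (x + g'))))"
proof -
  obtain B where B: "\<And>n g m j. g \<in> Graver (nfold r s t A n) \<Longrightarrow> m \<le> n \<Longrightarrow> j < t \<Longrightarrow>
      \<bar>\<Sum>p<m. g $ (p * t + j)\<bar> \<le> B"
    using Graver_nfold_partial_sums_bounded[OF assms] by blast
  define Z :: "(nat \<Rightarrow> int) set"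
    where "Z = {z. \<forall>j. (j \<in> {..<t} \<longrightarrow> z j \<in> {- \<bar>B\<bar>..\<bar>B\<bar>}) \<and> (j \<notin> {..<t} \<longrightarrow> z j = 0)}"
  have "finite Z" unfolding Z_def by (rule finite_set_of_finite_funs) auto
  then obtain zs where zs: "set zs = Z" "distinct zs" using finite_distinct_list by blast
  obtain e :: "(nat \<Rightarrow> int) \<Rightarrow> nat" where e: "inj_on e Z"
    using finite_imp_inj_to_nat_seg[OF \<open>finite Z\<close>] by blast
  define es where "es = filter (\<lambda>(z, w). annihilates A {r..<r + s} t (\<lambda>j. w j - z j)) (List.product zs zs)"
  define ts where "ts = filter (annihilates A {..<r} t) zs"
  have es_iff: "(z, w) \<in> set es \<longleftrightarrow> z \<in> Z \<and> w \<in> Z \<and> annihilates A {r..<r + s} t (\<lambda>j. w j - z j)" for z w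
    using zs by (auto simp: es_def)
  have ts_iff: "z \<in> set ts \<longleftrightarrow> z \<in> Z \<and> annihilates A {..<r} t z" for z
    using zs by (auto simp: ts_def)
  have zero: "(\<lambda>_. 0) \<in> Z" by (auto simp: Z_def)
  let ?P = "program t e es zs ts"
  let ?C = "max_steps (start e) + max_steps (stage t e es zs) + max_steps (select e ts) +
      max_steps (subtract t) + 100"
  show ?thesis
  proof (rule exI[of _ ?P], rule exI[of _ ?C], intro allI impI)
    fix n :: nat and b l u :: "int vec" and f :: "real vec \<Rightarrow> real" and x :: "int vec"
    assume n: "n \<ge> 1" and b: "b \<in> carrier_vec (r + n * s)"
      and l: "l \<in> carrier_vec (n * t)" and u: "u \<in> carrier_vec (n * t)"
      and f: "separable_convex n t f" and feas: "feasible (nfold r s t A n) b l u x"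
    let ?M = "nfold r s t A n"
    have M: "?M \<in> carrier_mat (r + n * s) (n * t)" by (intro carrier_matI) simp_all
    have x: "x \<in> carrier_vec (n * t)" "?M *\<^sub>v x = b" "l \<le> x" "x \<le> u"
      using feas by (auto simp: feasible_def)
    define F where "F = (\<lambda>a. at_int f (vec_of_array (n * t) a))"
    let ?l = "array_of_vec l" and ?u = "array_of_vec u" and ?x = "array_of_vec x"
    obtain \<phi> where \<phi>: "\<And>x. x \<in> carrier_vec (n * t) \<Longrightarrow> f x = (\<Sum>i<n. \<Sum>j<t. \<phi> i j (x $ (i * t + j)))"
      using f unfolding separable_convex_def by blast
    have F: "F y = (\<Sum>k<n * t. \<phi> (k div t) (k mod t) (real_of_int (y (int k))))" for y
    proof -
      have "F y = (\<Sum>i<n. \<Sum>j<t. \<phi> i j (real_of_int (y (int (i * t + j)))))"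
        using block_index_less by (simp add: F_def \<phi> vec_of_array_def)
      then show ?thesis unfolding sum_nat_blocks by simp
    qed
    interpret brick_program n t Z e es zs ts F "\<lambda>k v. \<phi> (k div t) (k mod t) (real_of_int v)" ?l ?u ?x
      using e es_iff zs ts_iff zero F by unfold_locales auto
    let ?\<sigma> = "input_state n b l u x"
    have cmp: "comparison (n * t) f = by_value F" by (simp add: comparison_def F_def fun_eq_iff)
    have entry: "array_of_vec v (int k) = v $ k" if "v \<in> carrier_vec (n * t)" "k < n * t" for v k
      using that by (simp add: array_of_vec_def flip: of_nat_mult)
    have Fx: "F ?x = at_int f x" "F x\<^sub>0 = at_int f x"
      using x(1) entry[OF x(1)] by (auto simp: F_def x\<^sub>0_def vec_of_array_def intro!: arg_cong[of _ _ "at_int f"])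
    obtain k \<tau> y where k: "exec (by_value F) ?P ?\<sigma> k \<tau>" "k \<le> ?C * n"
      and y: "y = x\<^sub>0 \<or> (\<exists>z\<in>set ts. y \<in> reach n z)" "\<forall>z\<in>set ts. \<forall>y'\<in>reach n z. F y \<le> F y'"
      and \<tau>: "if F ?x \<le> F y then scalars \<tau> 0 = 0
        else scalars \<tau> 0 \<noteq> 0 \<and> (\<forall>k. 0 \<le> k \<and> k < int (n * t) \<longrightarrow> arrays \<tau> 0 k = y k - ?x k)"
      using program_correct[OF n, of ?\<sigma>] by (auto simp: input_state_def)
    have Graver_le: "F y \<le> at_int f (x + g)" if g: "g \<in> Graver ?M" "feasible_step ?M b l u x g" for g
    proof -
      have gv: "g \<in> carrier_vec (n * t)" and gk: "?M *\<^sub>v g = 0\<^sub>v (r + n * s)"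
        using g(1) by (auto simp: Graver_def nonzero_kernel_def)
      have bnd: "l \<le> x + g" "x + g \<le> u" using g(2) by (auto simp: feasible_step_def feasible_def)
      have ker: "annihilates A {..<r} t (\<lambda>j. \<Sum>p<n. g $ (p * t + j))"
        "\<And>p. p < n \<Longrightarrow> annihilates A {r..<r + s} t (\<lambda>j. g $ (p * t + j))"
        using nfold_kernel_iff[OF assms gv] gk by auto
      define W where "W m j = (if j < t then \<Sum>p<m. g $ (p * t + j) else 0)" for m j
      define Y where "Y m k = (if 0 \<le> k \<and> k < int (m * t) then ?x k + g $ nat k else x\<^sub>0 k)" for m k
      have WZ: "W m \<in> Z" if "m \<le> n" for m
        using B[OF g(1) that] by (fastforce simp: W_def Z_def abs_le_iff)
      have "(W m, W (Suc m)) \<in> set es" if "m < n" for m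
        using WZ that ker(2)[OF that] by (auto simp: es_iff W_def annihilates_def)
      moreover have "in_box t m ?l ?u (\<lambda>k. ?x k + g $ nat k)" if "m < n" for m
        unfolding in_box_def
      proof (intro allI impI)
        fix j assume "j < t"
        then have less: "m * t + j < n * t" using block_index_less that by blast
        then show "?l (int (m * t + j)) \<le> ?x (int (m * t + j)) + g $ nat (int (m * t + j)) \<and>
            ?x (int (m * t + j)) + g $ nat (int (m * t + j)) \<le> ?u (int (m * t + j))"
          using bnd gv x(1) l u unfolding entry[OF l less] entry[OF u less] entry[OF x(1) less] nat_int
          by (auto simp: less_eq_vec_def)
      qed
      ultimately have "Y n \<in> reach n (W n)"
        using reach_complete[of n "\<lambda>k. g $ k"] unfolding W_def Y_def by simp
      moreover have "W n \<in> set ts"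
        using WZ[of n] ker(1) by (auto simp: ts_iff W_def annihilates_def)
      ultimately have "F y \<le> F (Y n)" using y(2) by blast
      also have "vec_of_array (n * t) (Y n) = x + g"
        using x(1) gv entry[OF x(1)] by (auto simp: vec_of_array_def Y_def simp flip: of_nat_mult)
      then have "F (Y n) = at_int f (x + g)" by (simp add: F_def)
      finally show ?thesis .
    qed
    have "case answer_of (n * t) \<tau> of
           Is_Optimal \<Rightarrow> optimal ?M b l u f x
         | Step g \<Rightarrow> augmenting_step ?M b l u f x g \<and>
             (\<forall>g' \<in> Graver ?M. feasible_step ?M b l u x g' \<longrightarrow> at_int f (x + g) \<le> at_int f (x + g'))"
    proof (cases "F ?x \<le> F y")
      case True
      have "optimal ?M b l u f x"
      proof (rule ccontr)
        assume "\<not> ?thesis"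
        then obtain y' where "feasible ?M b l u y'" "at_int f y' < at_int f x"
          using feas by (auto simp: optimal_def not_le)
        then obtain h where "h \<in> Graver ?M" "feasible_step ?M b l u x h" "at_int f (x + h) < at_int f x"
          using Graver_augmentation[OF f _ feas] by auto
        then show False using Graver_le[of h] True Fx by linarith
      qed
      then show ?thesis using True \<tau> by (simp add: answer_of_def)
    next
      case False
      then obtain z where z: "z \<in> set ts" "y \<in> reach n z" using y(1) Fx by auto
      define g where "g = vec_of_array (n * t) (arrays \<tau> 0)"
      have gv: "g \<in> carrier_vec (n * t)" by (simp add: g_def vec_of_array_def)
      have g_entry: "g $ k = y (int k) - ?x (int k)" if "k < n * t" for k
        using that \<tau> False by (simp add: g_def vec_of_array_def flip: of_nat_mult)
      have xg: "x + g = vec_of_array (n * t) y"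
        using x(1) gv entry[OF x(1)] g_entry by (auto simp: vec_of_array_def)
      then have Fy: "F y = at_int f (x + g)" by (simp add: F_def)
      have sound: "\<And>p. p < n \<Longrightarrow> annihilates A {r..<r + s} t (\<lambda>j. y (int (p * t + j)) - ?x (int (p * t + j)))"
        "\<And>p. p < n \<Longrightarrow> in_box t p ?l ?u y"
        "\<And>j. j < t \<Longrightarrow> z j = (\<Sum>p<n. y (int (p * t + j)) - ?x (int (p * t + j)))"
        using reach_sound[OF z(2), of A "{r..<r + s}"] es_iff by auto
      have g_brick: "g $ (p * t + j) = y (int (p * t + j)) - ?x (int (p * t + j))" if "p < n" "j < t" for p j
        using g_entry block_index_less[OF that] by blast
      have "annihilates A {r..<r + s} t (\<lambda>j. g $ (p * t + j))" if "p < n" for p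
        using sound(1)[OF that] by (subst annihilates_cong[OF g_brick[OF that]])
      moreover have "annihilates A {..<r} t (\<lambda>j. \<Sum>p<n. g $ (p * t + j))"
      proof (subst annihilates_cong)
        show "annihilates A {..<r} t z" using z(1) ts_iff by blast
        show "(\<Sum>p<n. g $ (p * t + j)) = z j" if "j < t" for j
          using sound(3)[OF that] g_brick[OF _ that] by simp
      qed
      ultimately have "?M *\<^sub>v g = 0\<^sub>v (r + n * s)" using nfold_kernel_iff[OF assms gv] by blast
      then have "?M *\<^sub>v (x + g) = b"
        using x gv b by (subst mult_add_distrib_mat_vec[OF M]) auto
      moreover have "l $ k \<le> (x + g) $ k \<and> (x + g) $ k \<le> u $ k" if "k < n * t" for k
      proof -
        have kk: "k div t < n" "k mod t < t"
          using that by (auto simp: less_mult_imp_div_less) (cases t; auto)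
        have "k = k div t * t + k mod t" by simp
        then show ?thesis
          using sound(2)[OF kk(1)] kk(2) entry[OF l that] entry[OF u that] that
          unfolding in_box_def xg vec_of_array_def by (metis index_vec)
      qed
      then have "l \<le> x + g" "x + g \<le> u" using l u gv by (auto simp: less_eq_vec_def)
      ultimately have "feasible_step ?M b l u x g"
        using x(1) gv by (simp add: feasible_step_def feasible_def)
      then show ?thesis
        using False \<tau> Graver_le by (simp add: answer_of_def augmenting_step_def Fx Fy not_le flip: g_def)
    qed
    then show "\<exists>k \<sigma>. exec (comparison (n * t) f) ?P ?\<sigma> k \<sigma> \<and> k \<le> ?C * n \<and>
        (case answer_of (n * t) \<sigma> of
           Is_Optimal \<Rightarrow> optimal ?M b l u f x
         | Step g \<Rightarrow> augmenting_step ?M b l u f x g \<and>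
             (\<forall>g' \<in> Graver ?M. feasible_step ?M b l u x g' \<longrightarrow> at_int f (x + g) \<le> at_int f (x + g')))"
      unfolding cmp using k by blast
  qed
qed

end
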